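(* Let $\mathbb{K}\in\{\mathbb{R},\mathbb{C}\}$ and let $T$ be a random matrix continuously distributed on $\mathbb{K}^{d\times r}$. Let $\{T_j\}_{j=1}^n$ be an i.i.d. sample of $T$, and let $\Gamma^{(n)}$ be the limit of the iteration $\Gamma_0=\frac1dI_d$, $\Gamma_{k+1}=\Gamma_k^{1/2}M_k^{-1}\Gamma_k^{1/2}/\operatorname{trace}(\Gamma_kM_k^{-1})$, $M_k=\frac{d}{n}\sum_{j=1}^n\frac{\Gamma_k^{1/2}T_jT_j^*\Gamma_k^{1/2}}{\operatorname{trace}(T_j^*\Gamma_kT_j)}$, applied to this sample. Then, as $n\to\infty$, $\Gamma^{(n)}$ converges almost surely to some positive definite matrix $\Gamma$, and $\Sigma:=\Gamma^{-1}$ satisfies $$\Sigma=d\,\mathbb{E}\frac{TT^*}{\operatorname{trace}(T^*\Sigma^{-1}T)}.$$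
   Context: "Continuously distributed" means the distribution of $T$ has a density with respect to Lebesgue measure on $\mathbb{K}^{d\times r}$. For such samples and sufficiently large $n$, the iteration converges (with probability one) to a positive definite limit $\Gamma^{(n)}$ satisfying $\frac{d}{n}\sum_{j}\frac{(\Gamma^{(n)})^{1/2}T_jT_j^*(\Gamma^{(n)})^{1/2}}{\operatorname{trace}(T_j^*\Gamma^{(n)}T_j)}=I_d$. $\Gamma^{1/2}$ denotes the positive definite square root. *)

theory Defs
  imports "HOL-Analysis.Analysis" "HOL-Probability.Probability"
begin

text \<open>Matrices over K are represented as complex matrices of type complex^'c^'r.
  The real case K = R is covered by matrices with real entries (see Kmat_lebesgue).\<close>

definition adj :: "complex^'c^'r \<Rightarrow> complex^'r^'c" where
  "adj A = (\<chi> i j. cnj (A $ j $ i))"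

definition mscale :: "complex \<Rightarrow> complex^'c^'r \<Rightarrow> complex^'c^'r" where
  "mscale c A = (\<chi> i j. c * A $ i $ j)"

definition pos_def :: "complex^'n^'n \<Rightarrow> bool" where
  "pos_def A \<longleftrightarrow> adj A = A \<and>
     (\<forall>x::complex^'n. x \<noteq> 0 \<longrightarrow>
        0 < Re (\<Sum>i\<in>UNIV. \<Sum>j\<in>UNIV. cnj (x $ i) * A $ i $ j * x $ j))"

definition psd_sqrt :: "complex^'n^'n \<Rightarrow> complex^'n^'n" where
  "psd_sqrt A = (THE B. pos_def B \<and> B ** B = A)"

definition Kmat_lebesgue :: "bool \<Rightarrow> (complex^'c^'r) measure" where
  "Kmat_lebesgue is_real =
     (if is_real then distr (lborel :: (real^'c^'r) measure) borel
                          (\<lambda>A. \<chi> i j. complex_of_real (A $ i $ j))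
      else lborel)"

definition M_mat :: "nat \<Rightarrow> (nat \<Rightarrow> complex^'r^'d) \<Rightarrow> complex^'d^'d \<Rightarrow> complex^'d^'d" where
  "M_mat n Ts G = mscale (of_nat CARD('d) / of_nat n)
     (\<Sum>j<n. mscale (1 / trace (adj (Ts j) ** G ** Ts j))
                   (psd_sqrt G ** Ts j ** adj (Ts j) ** psd_sqrt G))"

definition iter_step :: "nat \<Rightarrow> (nat \<Rightarrow> complex^'r^'d) \<Rightarrow> complex^'d^'d \<Rightarrow> complex^'d^'d" where
  "iter_step n Ts G =
     mscale (1 / trace (G ** matrix_inv (M_mat n Ts G)))
            (psd_sqrt G ** matrix_inv (M_mat n Ts G) ** psd_sqrt G)"

definition Gamma_iter :: "nat \<Rightarrow> (nat \<Rightarrow> complex^'r^'d) \<Rightarrow> nat \<Rightarrow> complex^'d^'d" where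
  "Gamma_iter n Ts k = (iter_step n Ts ^^ k) (mscale (1 / of_nat CARD('d)) (mat 1))"

end

theory Submission
  imports Defs
begin

text \<open>Write \<open>a G t = Re (tr (t\<^sup>* G t))\<close> and \<open>S G = d/n * \<Sum>j. T\<^sub>j T\<^sub>j\<^sup>* / a G T\<^sub>j\<close>. The iteration is
  \<open>G \<mapsto> (S G)\<inverse> / tr ((S G)\<inverse>)\<close>, a majorise-minimise scheme for the potential
  \<open>1/n * \<Sum>j. ln (a G T\<^sub>j / \<bar>T\<^sub>j\<bar>\<^sup>2) - 1/d * ln (det G)\<close>. If no slab around a hyperplane contains a fraction
  \<open>1/(2d)\<close> of the sample, the potential is coercive on trace one matrices, with bounds depending only on the width
  of the slabs; so the iterates stay in a fixed compact set, their limit points are fixed points \<open>G = (S G)\<inverse>\<close>,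
  and the fixed point is unique. Almost surely the slab condition holds for all large \<open>n\<close> with a common width.
  The law of large numbers, uniform over the compact set, makes every limit point of \<open>\<Gamma>\<^sup>(\<^sup>n\<^sup>)\<close> a fixed point of the
  population equation, which is unique for the same reason.\<close>

section \<open>Complex matrices\<close>

text \<open>The fraction 1/(2d) does two jobs. In the potential the least eigenvalue
  \<open>m\<close> of a trace one matrix enters \<open>- ln det / d\<close> with weight 1/d, while
  only samples in the slab belonging to a top eigenvector can have a term as low as
  \<open>ln m\<close>; with total weight at most 1/(2d) they cannot compensate. Moreover 1/(2d) is
  at most 1/2, so two vectors are never between them orthogonal to the whole sample, which is what
  uniqueness of the fixed point asks for. The obstacle in the limit of large samples is that the
  empirical fixed points are random, so a law of large numbers at a fixed parameter does not apply
  to them. The summand \<open>T T* / a G T\<close> is homogeneous of degree 0 in \<open>T\<close>: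
  on the compact set it is bounded and Lipschitz in \<open>G\<close>, uniformly in \<open>T\<close>,
  whatever the tails of \<open>T\<close>. Boundedness also allows a strong law by Hoeffding's
  inequality. Finally the limit must not depend on the outcome; uniqueness of the population fixed
  point settles this.\<close>

definition cdot :: "complex^'n \<Rightarrow> complex^'n \<Rightarrow> complex" where
  "cdot x y = (\<Sum>i\<in>UNIV. cnj (x $ i) * y $ i)"

text \<open>The library's \<open>\<bullet>\<close> on complex vectors is the real inner product. The
  Hermitian form of a self-adjoint matrix is real, so it can be written with
  \<open>\<bullet>\<close>; complex values of \<open>cdot\<close> matter for orthonormality.\<close>

lemma inner_eq_Re_cdot: "x \<bullet> y = Re (cdot x y)"
  by (simp add: cdot_def inner_vec_def inner_complex_def)

lemma cdot_add_left: "cdot (x + y) z = cdot x z + cdot y z"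
  and cdot_add_right: "cdot x (y + z) = cdot x y + cdot x z"
  and cdot_diff_left: "cdot (x - y) z = cdot x z - cdot y z"
  and cdot_diff_right: "cdot x (y - z) = cdot x y - cdot x z"
  and cdot_scale_left: "cdot (c *s x) y = cnj c * cdot x y"
  and cdot_scale_right: "cdot x (c *s y) = c * cdot x y"
  by (simp_all add: cdot_def algebra_simps sum.distrib sum_subtractf sum_distrib_left)

lemma cnj_cdot: "cnj (cdot x y) = cdot y x"
  by (simp add: cdot_def mult.commute)

lemma matrix_vector_mult_scale: "A *v (c *s x) = c *s (A *v (x :: complex^'n))"
  by (simp add: vec_eq_iff matrix_vector_mult_def sum_distrib_left mult_ac)

lemma adj_nth [simp]: "adj A $ i $ j = cnj (A $ j $ i)"
  by (simp add: adj_def)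

lemma adj_adj [simp]: "adj (adj A) = A"
  by (simp add: vec_eq_iff)

lemma adj_mult: "adj (A ** B) = adj B ** adj A"
  by (simp add: vec_eq_iff matrix_matrix_mult_def mult.commute)

lemma adj_add: "adj (A + B) = adj A + adj B"
  and adj_diff: "adj (A - B) = adj A - adj B"
  and adj_scaleR: "adj (c *\<^sub>R A) = c *\<^sub>R adj A"
  and adj_zero [simp]: "adj 0 = 0"
  by (simp_all add: vec_eq_iff)

lemma adj_mat_1 [simp]: "adj (mat 1) = mat 1"
  by (simp add: vec_eq_iff mat_def)

lemma adj_sum: "adj (\<Sum>i\<in>I. A i) = (\<Sum>i\<in>I. adj (A i))"
  by (induction I rule: infinite_finite_induct) (simp_all add: adj_add)

lemma cdot_adj_right: "cdot x (A *v y) = cdot (adj A *v x) y"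
proof -
  have "cdot x (A *v y) = (\<Sum>i\<in>UNIV. \<Sum>j\<in>UNIV. cnj (x $ i) * A $ i $ j * y $ j)"
    by (simp add: cdot_def matrix_vector_mult_def sum_distrib_left mult_ac)
  also have "\<dots> = cdot (adj A *v x) y"
    by (subst sum.swap) (simp add: cdot_def matrix_vector_mult_def sum_distrib_left sum_distrib_right mult_ac)
  finally show ?thesis .
qed

lemma inner_adj_right: "x \<bullet> (A *v y) = (adj A *v x) \<bullet> y" for A :: "complex^'n^'m"
  by (simp add: inner_eq_Re_cdot cdot_adj_right)

text \<open>The given definitions scale by complex numbers that turn out to be real; with
  \<open>*\<^sub>R\<close> the theory of limits and integrals in real vector spaces applies.\<close>

lemma mscale_of_real: "mscale (complex_of_real c) A = c *\<^sub>R A"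
  by (simp add: mscale_def vec_eq_iff) (simp add: scaleR_conv_of_real)

lemma scaleR_matrix_vector: "(c *\<^sub>R A) *v x = c *\<^sub>R (A *v x)" for A :: "complex^'n^'m"
  by (simp add: vec_eq_iff matrix_vector_mult_def scaleR_sum_right)

lemma matrix_vector_scaleR: "A *v (c *\<^sub>R x) = c *\<^sub>R (A *v x)" for A :: "complex^'n^'m"
  by (simp add: vec_eq_iff matrix_vector_mult_def scaleR_sum_right)

lemma matrix_mult_scaleR_left: "(c *\<^sub>R A) ** B = c *\<^sub>R (A ** B)" for A :: "complex^'n^'m"
  by (simp add: vec_eq_iff matrix_matrix_mult_def scaleR_sum_right)

lemma matrix_mult_scaleR_right: "A ** (c *\<^sub>R B) = c *\<^sub>R (A ** B)" for A :: "complex^'n^'m"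
  by (simp add: vec_eq_iff matrix_matrix_mult_def scaleR_sum_right)

lemma matrix_mult_diff_left: "(A - B) ** C = A ** C - B ** C" for A :: "complex^'n^'m"
  by (simp add: vec_eq_iff matrix_matrix_mult_def sum_subtractf algebra_simps)

lemma matrix_mult_diff_right: "C ** (A - B) = C ** A - C ** B" for A :: "complex^'n^'m"
  by (simp add: vec_eq_iff matrix_matrix_mult_def sum_subtractf algebra_simps)

lemma matrix_mult_sum_left: "(\<Sum>i\<in>I. A i) ** B = (\<Sum>i\<in>I. A i ** B)" for B :: "complex^'n^'m"
  by (induction I rule: infinite_finite_induct)
     (auto simp: vec_eq_iff matrix_matrix_mult_def algebra_simps sum.distrib)

lemma matrix_mult_sum_right: "B ** (\<Sum>i\<in>I. A i) = (\<Sum>i\<in>I. B ** A i)" for B :: "complex^'n^'m"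
  by (induction I rule: infinite_finite_induct)
     (auto simp: vec_eq_iff matrix_matrix_mult_def algebra_simps sum.distrib)

lemma bounded_bilinear_matrix_mult:
  "bounded_bilinear ((**) :: complex^'n^'m \<Rightarrow> complex^'k^'n \<Rightarrow> complex^'k^'m)"
  by (rule bilinear_conv_bounded_bilinear[THEN iffD1])
     (auto simp: bilinear_def linear_iff matrix_mult_scaleR_left matrix_mult_scaleR_right matrix_add_ldistrib
        vec_eq_iff matrix_matrix_mult_def algebra_simps sum.distrib scaleR_sum_right)

lemmas tendsto_matrix_mult [tendsto_intros] = bounded_bilinear.tendsto[OF bounded_bilinear_matrix_mult]
lemmas continuous_on_matrix_mult [continuous_intros] = bounded_bilinear.continuous_on[OF bounded_bilinear_matrix_mult]

lemma bounded_bilinear_matrix_vector: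
  "bounded_bilinear ((*v) :: complex^'n^'m \<Rightarrow> complex^'n \<Rightarrow> complex^'m)"
  by (rule bilinear_conv_bounded_bilinear[THEN iffD1])
     (auto simp: bilinear_def linear_iff scaleR_matrix_vector matrix_vector_scaleR algebra_simps)

lemmas continuous_on_matrix_vector [continuous_intros] = bounded_bilinear.continuous_on[OF bounded_bilinear_matrix_vector]

lemma bounded_linear_adj: "bounded_linear (adj :: complex^'n^'m \<Rightarrow> complex^'m^'n)"
  by (rule linear_conv_bounded_linear[THEN iffD1]) (simp add: linear_iff adj_add adj_scaleR)

lemmas continuous_on_adj [continuous_intros] = bounded_linear.continuous_on[OF bounded_linear_adj]

text \<open>Cauchy-Schwarz in each row: \<open>norm A\<close> is the Frobenius norm, which dominates
  the operator norm.\<close>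

lemma norm_matrix_vector_le: "norm (A *v x) \<le> norm A * norm x" for A :: "complex^'n^'m"
proof -
  have "norm ((A *v x) $ i) \<le> norm (A $ i) * norm x" for i
  proof -
    have "norm ((A *v x) $ i) \<le> (\<Sum>j\<in>UNIV. \<bar>norm (A $ i $ j)\<bar> * \<bar>norm (x $ j)\<bar>)"
      unfolding matrix_vector_mult_def by (auto intro!: sum_norm_le simp: norm_mult)
    also have "\<dots> \<le> norm (A $ i) * norm x"
      unfolding norm_vec_def by (rule L2_set_mult_ineq)
    finally show ?thesis .
  qed
  then have "norm (A *v x) \<le> L2_set (\<lambda>i. norm (A $ i) * norm x) UNIV"
    by (subst norm_vec_def, intro L2_set_mono) auto
  also have "\<dots> = norm A * norm x"
    by (subst (2) norm_vec_def) (simp add: L2_set_left_distrib)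
  finally show ?thesis .
qed

lemma norm_adj: "norm (adj A) = norm A"
proof -
  have "(norm (adj A))\<^sup>2 = (norm A)\<^sup>2"
    unfolding power2_norm_eq_inner
    by (simp add: inner_vec_def) (subst sum.swap, simp add: inner_complex_def)
  then show ?thesis by simp
qed

lemma inner_matrix_columns:
  "s \<bullet> t = (\<Sum>c\<in>UNIV. column c s \<bullet> column c t)" for t :: "complex^'r^'d"
  by (simp add: inner_vec_def column_def) (rule sum.swap)

lemma column_matrix_mult: "column c (A ** B) = A *v column c B"
  by (simp add: vec_eq_iff column_def matrix_matrix_mult_def matrix_vector_mult_def)

text \<open>The library's inner product on matrices is the Frobenius product, so
  \<open>t \<bullet> (G ** t)\<close> can stand for \<open>Re (trace (adj t ** G ** t))\<close>
  throughout.\<close>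

lemma Re_trace_adj_mult: "Re (trace (adj s ** t)) = s \<bullet> t" for s t :: "complex^'r^'d"
  by (simp add: inner_matrix_columns inner_eq_Re_cdot trace_def matrix_matrix_mult_def cdot_def column_def)

lemma trace_scaleR: "trace (c *\<^sub>R A) = c *\<^sub>R trace (A :: complex^'n^'n)"
  by (simp add: trace_def scaleR_sum_right)

lemma trace_sum: "trace (\<Sum>i\<in>I. A i) = (\<Sum>i\<in>I. trace (A i :: complex^'n^'n))"
  unfolding trace_def by (simp add: sum.swap[of _ I])

lemma trace_mult_commute: "trace (A ** B) = trace (B ** A)"
  for A :: "complex^'n^'m" and B :: "complex^'m^'n"
  unfolding trace_def matrix_matrix_mult_def by (simp, subst sum.swap) (simp add: mult.commute)

lemma trace_selfadjoint:
  assumes "adj A = A"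
  shows "trace A = of_real (Re (trace A))"
proof -
  have "cnj (trace A) = trace (adj A)" by (simp add: trace_def)
  then have "cnj (trace A) = trace A" using assms by simp
  then show ?thesis by (metis Reals_cnj_iff of_real_Re)
qed

lemma matrix_inv_unique: "matrix_inv A = B" if "A ** B = mat 1" "B ** A = mat 1"
  for A :: "complex^'n^'n"
proof -
  define C where "C = matrix_inv A"
  have "A ** C = mat 1 \<and> C ** A = mat 1"
    unfolding C_def matrix_inv_def by (rule someI[where x = B]) (use that in auto)
  then have "C ** (A ** B) = B"
    by (simp only: matrix_mul_assoc matrix_mul_lid)
  then show ?thesis using that by (simp add: C_def)
qed

lemma matrix_left_right_inverse_complex: "A ** B = mat 1 \<longleftrightarrow> B ** A = mat 1" for A B :: "complex^'n^'n"
  by (rule matrix_left_right_inverse)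

lemma tendsto_det:
  fixes A :: "'a \<Rightarrow> complex^'n^'n"
  assumes "(A \<longlongrightarrow> B) F"
  shows "((\<lambda>x. det (A x)) \<longlongrightarrow> det B) F"
  unfolding det_def by (intro tendsto_intros assms)

lemma bounded_linear_trace: "bounded_linear (trace :: complex^'n^'n \<Rightarrow> complex)"
  by (rule linear_conv_bounded_linear[THEN iffD1])
     (simp add: linear_iff trace_scaleR, simp add: trace_def sum.distrib)

lemmas continuous_on_trace [continuous_intros] = bounded_linear.continuous_on[OF bounded_linear_trace]

section \<open>The spectral theorem\<close>

definition diag :: "('n \<Rightarrow> real) \<Rightarrow> complex^'n^'n" where
  "diag l = (\<chi> i j. if i = j then of_real (l i) else 0)"

text \<open>The vectors are stored as rows, directly accessible as \<open>V $ i\<close>;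
  \<open>spectral\<close> turns them into columns.\<close>

definition orthonormal :: "(complex^'n^'n) set" where
  "orthonormal = {V. \<forall>i j. cdot (V $ i) (V $ j) = (if i = j then 1 else 0)}"

lemma compact_orthonormal: "compact (orthonormal :: (complex^'n^'n) set)"
  unfolding compact_eq_bounded_closed
proof
  have "norm V \<le> real CARD('n)" if "V \<in> orthonormal" for V :: "complex^'n^'n"
  proof -
    have "norm (V $ i) = 1" for i
      using that by (simp add: orthonormal_def norm_eq_sqrt_inner inner_eq_Re_cdot)
    then show ?thesis
      unfolding norm_vec_def[of V] using L2_set_le_sum[of UNIV "\<lambda>i. norm (V $ i)"] by simp
  qed
  then show "bounded (orthonormal :: (complex^'n^'n) set)"
    by (auto simp: bounded_iff)
  show "closed (orthonormal :: (complex^'n^'n) set)"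
    unfolding orthonormal_def cdot_def
    by (intro closed_Collect_all closed_Collect_eq continuous_intros)
qed

text \<open>Maximise \<open>\<Sum>i. c i * \<langle>v\<^sub>i, A v\<^sub>i\<rangle>\<close> with pairwise distinct weights over orthonormal families:
  at a maximiser, rotating in the plane of \<open>v\<^sub>p, v\<^sub>q\<close> shows \<open>\<langle>v\<^sub>p, A v\<^sub>q\<rangle> = 0\<close>.\<close>

lemma orthonormal_diagonalizing:
  fixes A :: "complex^'n^'n"
  assumes A: "adj A = A"
  obtains V :: "complex^'n^'n" where "V \<in> orthonormal" "\<And>p q. p \<noteq> q \<Longrightarrow> cdot (V $ p) (A *v V $ q) = 0"
proof -
  \<comment> \<open>With equal weights the functional would be a multiple of the trace, hence
    constant on orthonormal families.\<close>
  obtain c0 :: "'n \<Rightarrow> nat" where "inj c0"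
    using finite_imp_inj_to_nat_seg[of "UNIV :: 'n set"] by auto
  define c where "c i = real (c0 i)" for i
  have c: "c p \<noteq> c q" if "p \<noteq> q" for p q
    using \<open>inj c0\<close> that by (auto simp: c_def inj_def)
  define f where "f V = (\<Sum>i\<in>UNIV. c i * Re (cdot (V $ i) (A *v V $ i)))" for V :: "complex^'n^'n"
  have "(mat 1 :: complex^'n^'n) \<in> orthonormal"
  proof -
    have "cdot (mat 1 $ i) (mat 1 $ j) = ((mat 1 :: complex^'n^'n) ** adj (mat 1)) $ j $ i" for i j :: 'n
      by (simp only: cdot_def matrix_matrix_mult_def vec_lambda_beta adj_nth mult.commute)
    then show ?thesis
      by (simp add: orthonormal_def) (auto simp: mat_def)
  qed
  moreover have "continuous_on orthonormal f"
    unfolding f_def cdot_def by (intro continuous_intros)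
  ultimately obtain V where V: "V \<in> orthonormal" and max: "\<And>W. W \<in> orthonormal \<Longrightarrow> f W \<le> f V"
    using continuous_attains_sup[OF compact_orthonormal, of f] by blast
  have on: "cdot (V $ i) (V $ j) = (if i = j then 1 else 0)" for i j
    using V by (simp add: orthonormal_def)
  have "cdot (V $ p) (A *v V $ q) = 0" if pq: "p \<noteq> q" for p q
  proof (rule ccontr)
    define b where "b i j = cdot (V $ i) (A *v V $ j)" for i j
    assume "cdot (V $ p) (A *v V $ q) \<noteq> 0"
    then have b0: "b p q \<noteq> 0" by (simp add: b_def)
    have bqp: "b q p = cnj (b p q)"
      by (simp add: b_def cnj_cdot) (simp add: cdot_adj_right A)
    define x y where "x = Re (b p p)" and "y = Re (b q q)"
    define h where "h = \<bar>c p - c q\<bar> * norm (b p q)"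
    have h: "h > 0" using b0 c[OF pq] by (simp add: h_def)
    \<comment> \<open>A phase that makes the first-order gain
      \<open>(c p - c q) * Re (z * b p q)\<close> of the rotation equal to the positive number
      \<open>h\<close>.\<close>
    define z where "z = sgn (of_real (c p - c q)) * cnj (b p q) / norm (b p q)"
    have z1: "cnj z * z = 1"
    proof -
      have "norm z = 1" using b0 c[OF pq] by (simp add: z_def norm_mult norm_divide norm_sgn)
      then show ?thesis by (simp add: complex_norm_square[symmetric] mult.commute)
    qed
    have "z * b p q = sgn (of_real (c p - c q)) * (b p q * cnj (b p q)) / norm (b p q)"
      by (simp add: z_def)
    also have "\<dots> = sgn (of_real (c p - c q)) * of_real (norm (b p q))"
      using b0 by (simp add: complex_norm_square[symmetric] power2_eq_square)
    also have "\<dots> = of_real (sgn (c p - c q) * norm (b p q))"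
      by (simp only: sgn_of_real of_real_mult)
    finally have "z * b p q = of_real (sgn (c p - c q) * norm (b p q))" .
    then have zb: "Re (z * b p q) = sgn (c p - c q) * norm (b p q)" by simp
    have zh: "(c p - c q) * Re (z * b p q) = h"
      unfolding zb h_def by (metis abs_sgn mult.assoc)
    define D where "D = (c p - c q) * (x - y)"
    \<comment> \<open>Tangent of the rotation angle, whose cosine and sine are
      \<open>\<alpha>\<close> and \<open>\<beta>\<close>. It is so small that, up to the factor
      \<open>s * \<alpha>\<^sup>2\<close>, the second-order loss \<open>s * D\<close> is at most
      \<open>h\<close>, against a gain of \<open>2 * h\<close>.\<close>
    define s where "s = h / (\<bar>D\<bar> + 1)"
    have s: "s > 0" using h by (simp add: s_def)
    define \<alpha> where "\<alpha> = 1 / sqrt (1 + s\<^sup>2)"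
    define \<beta> where "\<beta> = s * \<alpha>"
    have \<alpha>: "\<alpha> > 0" using s by (simp add: \<alpha>_def add_pos_nonneg)
    have "1 + s\<^sup>2 > 0" by (simp add: add_pos_nonneg)
    then have "\<alpha>\<^sup>2 * (1 + s\<^sup>2) = 1" by (simp add: \<alpha>_def power_divide)
    then have \<alpha>\<beta>: "\<alpha>\<^sup>2 + \<beta>\<^sup>2 = 1"
      by (simp add: \<beta>_def power_mult_distrib algebra_simps)
    then have \<alpha>\<beta>c: "of_real \<alpha> * of_real \<alpha> + of_real \<beta> * of_real \<beta> = (1 :: complex)"
      by (simp add: power2_eq_square flip: of_real_mult of_real_add)
    define wp wq where "wp = of_real \<alpha> *s V $ p + (of_real \<beta> * z) *s V $ q"
      and "wq = (- of_real \<beta> * cnj z) *s V $ p + of_real \<alpha> *s V $ q"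
    define W :: "complex^'n^'n" where "W = (\<chi> k. if k = p then wp else if k = q then wq else V $ k)"
    have "cdot wp wp = of_real \<alpha> * of_real \<alpha> + of_real \<beta> * of_real \<beta> * (cnj z * z)"
      "cdot wq wq = of_real \<beta> * of_real \<beta> * (cnj z * z) + of_real \<alpha> * of_real \<alpha>"
      using pq by (simp_all add: wp_def wq_def cdot_add_left cdot_add_right cdot_diff_left cdot_diff_right cdot_scale_left cdot_scale_right on)
    then have pp: "cdot wp wp = 1" "cdot wq wq = 1"
      using \<alpha>\<beta>c by (simp_all add: z1 add.commute)
    have "cdot wp wq = 0" "cdot wq wp = 0"
      using pq by (simp_all add: wp_def wq_def cdot_add_left cdot_add_right cdot_diff_left cdot_diff_right cdot_scale_left cdot_scale_right on)
    moreover have "cdot wp (V $ k) = 0" "cdot wq (V $ k) = 0" "cdot (V $ k) wp = 0" "cdot (V $ k) wq = 0"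
      if "k \<noteq> p" "k \<noteq> q" for k
      using that
      by (simp_all add: wp_def wq_def cdot_add_left cdot_add_right cdot_diff_left cdot_diff_right cdot_scale_left cdot_scale_right on)
    ultimately have "W \<in> orthonormal"
      using pp pq by (auto simp: orthonormal_def W_def on)
    then have le: "f W \<le> f V" by (rule max)
    have split: "(\<Sum>i\<in>UNIV. g i) = g p + g q + (\<Sum>i\<in>UNIV - {p, q}. g i)" for g :: "'n \<Rightarrow> real"
    proof -
      have "(\<Sum>i\<in>UNIV. g i) = (\<Sum>i\<in>UNIV - {p, q}. g i) + (\<Sum>i\<in>{p, q}. g i)"
        by (rule sum.subset_diff) auto
      then show ?thesis using pq by simp
    qed
    have "(\<Sum>i\<in>UNIV - {p, q}. c i * Re (cdot (W $ i) (A *v W $ i)))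
        = (\<Sum>i\<in>UNIV - {p, q}. c i * Re (cdot (V $ i) (A *v V $ i)))"
      by (rule sum.cong) (auto simp: W_def)
    then have diff: "f W - f V = c p * (Re (cdot wp (A *v wp)) - x) + c q * (Re (cdot wq (A *v wq)) - y)"
      using pq by (simp add: f_def split W_def x_def y_def b_def algebra_simps)
    define m where "m = Re (z * b p q)"
    have "cdot wp (A *v wp) = (of_real \<alpha>)\<^sup>2 * b p p + (of_real \<beta>)\<^sup>2 * (cnj z * z) * b q q
        + of_real (\<alpha> * \<beta>) * (z * b p q + cnj z * b q p)"
      by (simp add: wp_def cdot_add_left cdot_add_right cdot_diff_left cdot_diff_right cdot_scale_left cdot_scale_right
          matrix_vector_right_distrib matrix_vector_mult_diff_distrib matrix_vector_mult_scale b_def power2_eq_square algebra_simps)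
    then have wp: "Re (cdot wp (A *v wp)) = \<alpha>\<^sup>2 * x + \<beta>\<^sup>2 * y + 2 * (\<alpha> * \<beta>) * m"
      unfolding z1 bqp x_def y_def
      by (simp add: m_def power2_eq_square flip: of_real_mult)
    have "cdot wq (A *v wq) = (of_real \<alpha>)\<^sup>2 * b q q + (of_real \<beta>)\<^sup>2 * (cnj z * z) * b p p
        - of_real (\<alpha> * \<beta>) * (z * b p q + cnj z * b q p)"
      by (simp add: wq_def cdot_add_left cdot_add_right cdot_diff_left cdot_diff_right cdot_scale_left cdot_scale_right
          matrix_vector_right_distrib matrix_vector_mult_diff_distrib matrix_vector_mult_scale b_def power2_eq_square algebra_simps)
    then have wq: "Re (cdot wq (A *v wq)) = \<alpha>\<^sup>2 * y + \<beta>\<^sup>2 * x - 2 * (\<alpha> * \<beta>) * m"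
      unfolding z1 bqp x_def y_def
      by (simp add: m_def power2_eq_square flip: of_real_mult)
    have \<alpha>2: "\<alpha>\<^sup>2 = 1 - \<beta>\<^sup>2" using \<alpha>\<beta> by simp
    have "f W - f V = 2 * (\<alpha> * \<beta>) * ((c p - c q) * m) - \<beta>\<^sup>2 * D"
      unfolding diff wp wq \<alpha>2 D_def by algebra
    also have "\<dots> = s * \<alpha>\<^sup>2 * (2 * h - s * D)"
      using zh by (simp add: m_def \<beta>_def power2_eq_square algebra_simps)
    finally have "s * \<alpha>\<^sup>2 * (2 * h - s * D) \<le> 0" using le by simp
    then have "2 * h \<le> s * D"
      using s \<alpha> by (simp add: mult_le_0_iff)
    also have "s * D \<le> h"
    proof -
      have "s * D \<le> s * (\<bar>D\<bar> + 1)" using s by (intro mult_left_mono) auto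
      also have "\<dots> = h" by (simp add: s_def)
      finally show ?thesis .
    qed
    finally show False using h by simp
  qed
  with V that show ?thesis by blast
qed

theorem spectral:
  fixes A :: "complex^'n^'n"
  assumes A: "adj A = A"
  obtains U :: "complex^'n^'n" and l where "adj U ** U = mat 1" "U ** adj U = mat 1" "A = U ** diag l ** adj U"
proof -
  obtain V where V: "V \<in> orthonormal" and 0: "\<And>p q. p \<noteq> q \<Longrightarrow> cdot (V $ p) (A *v V $ q) = 0"
    using orthonormal_diagonalizing[OF A] by metis
  \<comment> \<open>Then \<open>adj U ** A ** U\<close> has the entries
    \<open>cdot (V $ i) (A *v V $ j)\<close>, which vanish off the diagonal.\<close>
  define U :: "complex^'n^'n" where "U = (\<chi> i j. V $ j $ i)"
  define l where "l i = Re (cdot (V $ i) (A *v V $ i))" for i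
  have entry: "(adj U ** B ** U) $ i $ j = cdot (V $ i) (B *v V $ j)" for i j and B :: "complex^'n^'n"
  proof -
    have "(adj U ** (B ** U)) $ i $ j = cdot (V $ i) (B *v V $ j)"
      by (simp add: cdot_def matrix_matrix_mult_def matrix_vector_mult_def U_def)
    then show ?thesis by (simp add: matrix_mul_assoc)
  qed
  have U1: "adj U ** U = mat 1"
    using entry[of "mat 1"] V unfolding vec_eq_iff by (simp add: orthonormal_def) (simp add: mat_def)
  then have U2: "U ** adj U = mat 1" by (simp add: matrix_left_right_inverse_complex)
  have "cdot (V $ i) (A *v V $ i) = of_real (l i)" for i
  proof -
    have "cnj (cdot (V $ i) (A *v V $ i)) = cdot (V $ i) (A *v V $ i)"
      by (simp add: cnj_cdot) (simp add: cdot_adj_right A)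
    then show ?thesis by (metis l_def Reals_cnj_iff of_real_Re)
  qed
  then have D: "adj U ** A ** U = diag l"
    by (auto simp: vec_eq_iff entry diag_def 0)
  have "U ** diag l ** adj U = (U ** adj U) ** A ** (U ** adj U)"
    by (simp add: D[symmetric] matrix_mul_assoc)
  then have "A = U ** diag l ** adj U" using U2 by simp
  with U1 U2 show ?thesis by (rule that)
qed

section \<open>Positive definite matrices\<close>

lemma inner_adj_right_matrix: "s \<bullet> (A ** t) = (adj A ** s) \<bullet> t" for t :: "complex^'r^'d"
  by (simp add: inner_matrix_columns column_matrix_mult inner_adj_right)

lemma pos_def_iff: "pos_def A \<longleftrightarrow> adj A = A \<and> (\<forall>x. x \<noteq> 0 \<longrightarrow> 0 < x \<bullet> (A *v x))"
proof -
  have "Re (\<Sum>i\<in>UNIV. \<Sum>j\<in>UNIV. cnj (x $ i) * A $ i $ j * x $ j) = x \<bullet> (A *v x)" for x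
    by (simp only: inner_eq_Re_cdot cdot_def matrix_vector_mult_def vec_lambda_beta sum_distrib_left mult.assoc)
  then show ?thesis by (simp add: pos_def_def)
qed

lemma pos_def_adj: "pos_def A \<Longrightarrow> adj A = A"
  by (simp add: pos_def_iff)

lemma adj_diag [simp]: "adj (diag l) = diag l"
  by (auto simp: vec_eq_iff diag_def)

lemma diag_mult_nth: "(diag l ** t) $ i = l i *\<^sub>R t $ i"
  by (simp add: vec_eq_iff diag_def matrix_matrix_mult_def if_distribR if_distrib[of "\<lambda>x. x * _"] cong: if_cong)
     (simp add: scaleR_conv_of_real)

lemma diag_vector_nth: "(diag l *v x) $ i = l i *\<^sub>R x $ i"
  by (simp add: diag_def matrix_vector_mult_def if_distribR if_distrib[of "\<lambda>x. x * _"] cong: if_cong)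
     (simp add: scaleR_conv_of_real)

lemma diag_mult_diag: "diag l ** diag m = diag (\<lambda>i. l i * m i)"
  by (simp add: vec_eq_iff diag_mult_nth) (simp add: diag_def scaleR_conv_of_real)

lemma scaleR_diag: "c *\<^sub>R diag l = diag (\<lambda>i. c * l i)"
  by (simp add: vec_eq_iff diag_def) (simp add: scaleR_conv_of_real)

lemma diag_one: "diag (\<lambda>_. 1) = mat 1"
  by (simp add: vec_eq_iff diag_def mat_def)

text \<open>Functional calculus: inverses and square roots are obtained by acting on the eigenvalues
  with \<open>U\<close> kept fixed.\<close>

lemma conj_diag_mult:
  assumes "adj U ** U = mat 1"
  shows "(U ** diag l ** adj U) ** (U ** diag m ** adj U) = U ** diag (\<lambda>i. l i * m i) ** adj U"
proof -
  have "(U ** diag l ** adj U) ** (U ** diag m ** adj U) = U ** diag l ** (adj U ** U) ** diag m ** adj U"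
    by (simp only: matrix_mul_assoc)
  also have "\<dots> = U ** (diag l ** diag m) ** adj U"
    by (simp only: assms matrix_mul_rid matrix_mul_assoc)
  finally show ?thesis by (simp add: diag_mult_diag)
qed

lemma conj_diag_inner: "x \<bullet> ((U ** diag l ** adj U) *v x) = (\<Sum>i\<in>UNIV. l i * (norm ((adj U *v x) $ i))\<^sup>2)"
proof -
  have "x \<bullet> ((U ** diag l ** adj U) *v x) = (adj U *v x) \<bullet> (diag l *v (adj U *v x))"
    by (simp add: inner_adj_right flip: matrix_vector_mul_assoc)
  then show ?thesis
    by (simp add: inner_vec_def diag_vector_nth power2_norm_eq_inner)
qed

lemma conj_diag_inner_matrix:
  fixes t :: "complex^'r^'d"
  shows "t \<bullet> ((U ** diag l ** adj U) ** t) = (\<Sum>i\<in>UNIV. l i * (norm ((adj U ** t) $ i))\<^sup>2)"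
proof -
  have "t \<bullet> (U ** (diag l ** (adj U ** t))) = (adj U ** t) \<bullet> (diag l ** (adj U ** t))"
    by (rule inner_adj_right_matrix)
  then have "t \<bullet> ((U ** diag l ** adj U) ** t) = (adj U ** t) \<bullet> (diag l ** (adj U ** t))"
    by (simp only: matrix_mul_assoc)
  then show ?thesis
    by (simp add: inner_vec_def[of _ "diag l ** _"] diag_mult_nth power2_norm_eq_inner)
qed

lemma det_conj_diag:
  fixes U :: "complex^'n^'n"
  assumes "adj U ** U = mat 1"
  shows "det (U ** diag l ** adj U) = of_real (\<Prod>i\<in>UNIV. l i)"
proof -
  have "det (adj U) * det U = 1" by (metis assms det_mul det_I)
  then have "det (U ** diag l ** adj U) = det (diag l)"
    by (simp add: det_mul mult_ac)
  also have "\<dots> = (\<Prod>i\<in>UNIV. diag l $ i $ i)"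
    by (rule det_diagonal) (simp add: diag_def)
  finally show ?thesis by (simp add: diag_def)
qed

lemma trace_conj_diag:
  assumes "adj U ** U = mat 1"
  shows "trace (U ** diag l ** adj U) = of_real (\<Sum>i\<in>UNIV. l i)"
proof -
  have "trace (U ** diag l ** adj U) = trace (adj U ** U ** diag l)"
    by (subst trace_mult_commute) (simp add: matrix_mul_assoc)
  then show ?thesis by (simp add: assms trace_def diag_def)
qed

lemma pos_def_conj_diag:
  assumes "U ** adj U = mat 1" "\<And>i. l i > 0"
  shows "pos_def (U ** diag l ** adj U)"
  unfolding pos_def_iff
proof (intro conjI allI impI)
  show "adj (U ** diag l ** adj U) = U ** diag l ** adj U"
    by (simp add: adj_mult matrix_mul_assoc)
  fix x :: "complex^'a" assume "x \<noteq> 0"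
  moreover have "U *v (adj U *v x) = x" by (simp add: matrix_vector_mul_assoc assms)
  ultimately have "adj U *v x \<noteq> 0" by (metis matrix_vector_mult_0_right)
  then obtain j where "(adj U *v x) $ j \<noteq> 0" by (auto simp: vec_eq_iff)
  then have "0 < l j * (norm ((adj U *v x) $ j))\<^sup>2" using assms(2)[of j] by simp
  also have "\<dots> \<le> (\<Sum>i\<in>UNIV. l i * (norm ((adj U *v x) $ i))\<^sup>2)"
    by (rule member_le_sum) (auto intro!: mult_nonneg_nonneg less_imp_le[OF assms(2)])
  finally show "0 < x \<bullet> ((U ** diag l ** adj U) *v x)" by (simp only: conj_diag_inner)
qed

lemma pos_def_spectral:
  fixes A :: "complex^'n^'n"
  assumes "pos_def A"
  obtains U :: "complex^'n^'n" and l where "adj U ** U = mat 1" "U ** adj U = mat 1"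
    "A = U ** diag l ** adj U" "\<And>i. l i > 0"
proof -
  obtain U :: "complex^'n^'n" and l
    where U: "adj U ** U = mat 1" "U ** adj U = mat 1" and A: "A = U ** diag l ** adj U"
    using spectral[OF pos_def_adj[OF assms]] .
  have "l i > 0" for i
  proof -
    \<comment> \<open>The form of \<open>A\<close> at the eigenvector \<open>U *v axis i 1\<close>
      has the value \<open>l i\<close>.\<close>
    have e: "adj U *v (U *v axis i 1) = axis i 1"
      by (simp add: matrix_vector_mul_assoc U)
    then have "U *v axis i 1 \<noteq> 0" by (metis matrix_vector_mult_0_right axis_eq_0_iff zero_neq_one)
    then have "0 < (\<Sum>j\<in>UNIV. l j * (norm ((adj U *v (U *v axis i 1)) $ j))\<^sup>2)"
      using assms unfolding pos_def_iff A conj_diag_inner by blast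
    also have "\<dots> = (\<Sum>j\<in>UNIV. if j = i then l i else 0)"
      unfolding e by (rule sum.cong) (auto simp: axis_def)
    finally show ?thesis by simp
  qed
  with U A that show ?thesis by blast
qed

lemma pos_def_scaleR: "pos_def A \<Longrightarrow> c > 0 \<Longrightarrow> pos_def (c *\<^sub>R A)"
  by (simp add: pos_def_iff adj_scaleR scaleR_matrix_vector)

lemma pos_def_inverse:
  assumes "pos_def (A :: complex^'n^'n)"
  shows pos_def_matrix_inv: "pos_def (matrix_inv A)"
    and pos_def_inv_right: "A ** matrix_inv A = mat 1"
    and pos_def_inv_left: "matrix_inv A ** A = mat 1"
proof -
  obtain U :: "complex^'n^'n" and l where U: "adj U ** U = mat 1" "U ** adj U = mat 1"
    and A: "A = U ** diag l ** adj U" and l: "\<And>i. l i > 0"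
    using pos_def_spectral[OF assms] by metis
  define B where "B = U ** diag (\<lambda>i. inverse (l i)) ** adj U"
  have nz: "l i \<noteq> 0" for i using l[of i] by simp
  have AB: "A ** B = mat 1" "B ** A = mat 1"
    by (simp_all add: A B_def conj_diag_mult[OF U(1)] nz diag_one U)
  then have B: "matrix_inv A = B" by (rule matrix_inv_unique)
  show "pos_def (matrix_inv A)"
    unfolding B B_def by (rule pos_def_conj_diag) (auto simp: U l)
  show "A ** matrix_inv A = mat 1" "matrix_inv A ** A = mat 1"
    using AB by (simp_all add: B)
qed

lemma pos_def_det:
  assumes "pos_def (A :: complex^'n^'n)"
  shows pos_def_det_pos: "Re (det A) > 0"
    and pos_def_det_real: "det A = of_real (Re (det A))"
    and pos_def_det_scaleR: "Re (det (c *\<^sub>R A)) = c ^ CARD('n) * Re (det A)"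
    and pos_def_trace_pos: "Re (trace A) > 0"
proof -
  obtain U :: "complex^'n^'n" and l where U: "adj U ** U = mat 1" "U ** adj U = mat 1"
    and A: "A = U ** diag l ** adj U" and l: "\<And>i. l i > 0"
    using pos_def_spectral[OF assms] by metis
  have cA: "c *\<^sub>R A = U ** diag (\<lambda>i. c * l i) ** adj U"
    by (simp add: A matrix_mult_scaleR_left matrix_mult_scaleR_right flip: scaleR_diag)
  have det: "Re (det A) = (\<Prod>i\<in>UNIV. l i)"
    by (simp only: A det_conj_diag[OF U(1)] Re_complex_of_real)
  then show "Re (det A) > 0" by (auto intro: prod_pos l)
  show "det A = of_real (Re (det A))"
    by (simp only: A det_conj_diag[OF U(1)] Re_complex_of_real)
  show "Re (det (c *\<^sub>R A)) = c ^ CARD('n) * Re (det A)"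
    unfolding det by (simp only: cA det_conj_diag[OF U(1)] Re_complex_of_real prod.distrib prod_constant)
  show "Re (trace A) > 0"
    unfolding A trace_conj_diag[OF U(1)] by (auto intro!: sum_pos l)
qed

lemma pos_def_det_mult:
  assumes "pos_def A" "pos_def B"
  shows "Re (det (A ** B)) = Re (det A) * Re (det B)"
  unfolding det_mul by (subst pos_def_det_real[OF assms(1)]) simp

text \<open>Arithmetic-geometric mean inequality for the eigenvalues: sum
  \<open>ln x \<le> x - 1\<close>, where equality forces \<open>x = 1\<close>.\<close>

lemma det_le_one:
  fixes A :: "complex^'n^'n"
  assumes "pos_def A" and tr: "Re (trace A) = CARD('n)"
  shows ln_det_nonpos: "ln (Re (det A)) \<le> 0"
    and det_one_imp_mat_1: "Re (det A) = 1 \<Longrightarrow> A = mat 1"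
proof -
  obtain U :: "complex^'n^'n" and l where U: "adj U ** U = mat 1" "U ** adj U = mat 1"
    and A: "A = U ** diag l ** adj U" and l: "\<And>i. l i > 0"
    using pos_def_spectral[OF assms(1)] by metis
  have ln: "ln (Re (det A)) = (\<Sum>i\<in>UNIV. ln (l i))"
    unfolding A det_conj_diag[OF U(1)] Re_complex_of_real by (rule ln_prod) (auto, metis l less_irrefl)
  have sum0: "(\<Sum>i\<in>UNIV. l i - 1) = 0"
    using tr unfolding A trace_conj_diag[OF U(1)] by (simp add: sum_subtractf)
  have le: "ln (l i) \<le> l i - 1" for i by (rule ln_le_minus_one[OF l])
  show "ln (Re (det A)) \<le> 0"
    unfolding ln sum0[symmetric] by (rule sum_mono[OF le])
  show "A = mat 1" if "Re (det A) = 1"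
  proof -
    have "(\<Sum>i\<in>UNIV. (l i - 1) - ln (l i)) = 0"
      using ln sum0 that by (simp add: sum_subtractf)
    then have "(l i - 1) - ln (l i) = 0" for i
      using le by (subst (asm) sum_nonneg_eq_0_iff) auto
    then have "l i = 1" for i using ln_eq_minus_one[OF l[of i]] by simp
    then have "l = (\<lambda>_. 1)" by auto
    then show ?thesis by (simp add: A diag_one U)
  qed
qed

lemma pos_def_sqrt_exists:
  assumes "pos_def (A :: complex^'n^'n)"
  shows "\<exists>B. pos_def B \<and> B ** B = A"
proof -
  obtain U :: "complex^'n^'n" and l where U: "adj U ** U = mat 1" "U ** adj U = mat 1"
    and A: "A = U ** diag l ** adj U" and l: "\<And>i. l i > 0"
    using pos_def_spectral[OF assms] by metis
  have "sqrt (l i) * sqrt (l i) = l i" for i using l[of i] by simp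
  then have "(U ** diag (\<lambda>i. sqrt (l i)) ** adj U) ** (U ** diag (\<lambda>i. sqrt (l i)) ** adj U) = A"
    by (simp add: A conj_diag_mult[OF U(1)])
  moreover have "pos_def (U ** diag (\<lambda>i. sqrt (l i)) ** adj U)"
    by (rule pos_def_conj_diag) (auto simp: U l)
  ultimately show ?thesis by blast
qed

lemma pos_def_inner_matrix_pos:
  fixes t :: "complex^'r^'d"
  assumes "pos_def G" "t \<noteq> 0"
  shows "0 < t \<bullet> (G ** t)"
proof -
  have nn: "0 \<le> column c t \<bullet> (G *v column c t)" for c
    using assms(1) by (cases "column c t = 0") (auto simp: pos_def_iff less_imp_le)
  obtain i c where "t $ i $ c \<noteq> 0" using assms(2) by (auto simp: vec_eq_iff)
  then have "column c t \<noteq> 0" by (auto simp: column_def vec_eq_iff)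
  then have "0 < column c t \<bullet> (G *v column c t)"
    using assms(1) by (auto simp: pos_def_iff)
  also have "\<dots> \<le> t \<bullet> (G ** t)"
    unfolding inner_matrix_columns column_matrix_mult by (rule member_le_sum) (auto intro: nn)
  finally show ?thesis .
qed

text \<open>If \<open>B\<^sup>2 = C\<^sup>2\<close> and \<open>D = B - C\<close> then \<open>B D + D C = 0\<close>; pairing with \<open>D\<close> gives
  \<open>tr (D B D) + tr (D C D) = 0\<close>.\<close>

lemma pos_def_sqrt_unique:
  fixes B C :: "complex^'n^'n"
  assumes B: "pos_def B" and C: "pos_def C" and eq: "B ** B = C ** C"
  shows "B = C"
proof (rule ccontr)
  assume "B \<noteq> C"
  define D where "D = B - C"
  have D: "D \<noteq> 0" "adj D = D"
    using \<open>B \<noteq> C\<close> pos_def_adj[OF B] pos_def_adj[OF C] by (simp_all add: D_def adj_diff)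
  have "B ** D + D ** C = 0"
    by (simp add: D_def matrix_mult_diff_left matrix_mult_diff_right eq)
  then have "D \<bullet> (B ** D) + D \<bullet> (D ** C) = 0"
    by (simp flip: inner_add_right)
  moreover have "D \<bullet> (D ** C) = D \<bullet> (C ** D)"
    unfolding Re_trace_adj_mult[symmetric] D by (subst trace_mult_commute) (simp add: matrix_mul_assoc)
  ultimately show False
    using pos_def_inner_matrix_pos[OF B D(1)] pos_def_inner_matrix_pos[OF C D(1)] by simp
qed

lemma psd_sqrt:
  assumes "pos_def A"
  shows pos_def_psd_sqrt: "pos_def (psd_sqrt A)"
    and psd_sqrt_mult_self: "psd_sqrt A ** psd_sqrt A = A"
proof -
  have "\<exists>!B. pos_def B \<and> B ** B = A"
    using pos_def_sqrt_exists[OF assms] by (auto intro: pos_def_sqrt_unique)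
  from theI'[OF this] show "pos_def (psd_sqrt A)" "psd_sqrt A ** psd_sqrt A = A"
    by (simp_all add: psd_sqrt_def)
qed

text \<open>The trace of \<open>A\<close> is the squared Frobenius norm of its square root, and this
  norm is submultiplicative up to a constant.\<close>

lemma norm_le_if_trace_1: "\<exists>K. \<forall>A :: complex^'n^'n. pos_def A \<longrightarrow> Re (trace A) = 1 \<longrightarrow> norm A \<le> K"
proof -
  obtain K where K: "\<And>A B. norm ((A :: complex^'n^'n) ** (B :: complex^'n^'n)) \<le> norm A * norm B * K"
    using bounded_bilinear.bounded[OF bounded_bilinear_matrix_mult] by blast
  have "norm A \<le> K" if "pos_def A" "Re (trace A) = 1" for A :: "complex^'n^'n"
  proof -
    have "psd_sqrt A \<bullet> psd_sqrt A = 1"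
      using that psd_sqrt[OF that(1)] by (simp add: pos_def_adj flip: Re_trace_adj_mult)
    then have "norm (psd_sqrt A) = 1" by (simp add: norm_eq_sqrt_inner)
    then show ?thesis using K[of "psd_sqrt A" "psd_sqrt A"] psd_sqrt_mult_self[OF that(1)] by simp
  qed
  then show ?thesis by blast
qed

lemma pos_def_sandwich:
  assumes "pos_def A" "pos_def B"
  shows "pos_def (A ** B ** A)"
  unfolding pos_def_iff
proof (intro conjI allI impI)
  show "adj (A ** B ** A) = A ** B ** A"
    using assms by (simp add: adj_mult pos_def_adj matrix_mul_assoc)
  fix x :: "complex^'a" assume "x \<noteq> 0"
  then have "A *v x \<noteq> 0"
    using assms(1) by (auto simp: pos_def_iff)
  then have "0 < (A *v x) \<bullet> (B *v (A *v x))"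
    using assms(2) by (auto simp: pos_def_iff)
  then show "0 < x \<bullet> ((A ** B ** A) *v x)"
    by (simp add: inner_adj_right pos_def_adj[OF assms(1)] flip: matrix_vector_mul_assoc)
qed

section \<open>Uniqueness of the fixed point\<close>

text \<open>A short move from \<open>y\<close> in the direction \<open>- N *v y\<close> would make
  the form negative. The length \<open>s\<close> is chosen so that the quadratic term cancels at
  most half of the negative linear one.\<close>

lemma psd_kernel:
  fixes N :: "complex^'n^'n"
  assumes N: "adj N = N" and psd: "\<And>x. 0 \<le> x \<bullet> (N *v x)" and y: "y \<bullet> (N *v y) = 0"
  shows "N *v y = 0"
proof (rule ccontr)
  define z where "z = N *v y"
  assume "N *v y \<noteq> 0"
  then have z: "z \<bullet> z > 0" by (simp add: z_def)
  define q where "q = z \<bullet> (N *v z)"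
  have q: "q \<ge> 0" by (simp add: q_def psd)
  define s where "s = (z \<bullet> z) / (q + 1)"
  have s: "s > 0" using z q by (simp add: s_def)
  have "y \<bullet> (N *v z) = z \<bullet> z" by (simp add: inner_adj_right N z_def)
  then have "(y - s *\<^sub>R z) \<bullet> (N *v (y - s *\<^sub>R z)) = - 2 * s * (z \<bullet> z) + s * s * q"
    using y by (simp add: matrix_vector_mult_diff_distrib matrix_vector_scaleR inner_diff_left inner_diff_right
        q_def inner_commute[of _ "N *v y"] flip: z_def) (simp add: z_def inner_commute algebra_simps)
  with psd[of "y - s *\<^sub>R z"] have "s * (2 * (z \<bullet> z)) \<le> s * (s * q)" by (simp add: algebra_simps)
  then have "2 * (z \<bullet> z) \<le> s * q" using s by simp
  also have "s * q \<le> z \<bullet> z" using z q by (simp add: s_def divide_simps)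
  finally show False using z by simp
qed

lemma inner_matrix_lower_bound:
  fixes t :: "complex^'r^'d"
  assumes "\<And>x. c * (x \<bullet> x) \<le> x \<bullet> (G *v x)"
  shows "c * (norm t)\<^sup>2 \<le> t \<bullet> (G ** t)"
  unfolding power2_norm_eq_inner inner_matrix_columns column_matrix_mult sum_distrib_left
  by (rule sum_mono) (rule assms)

lemma psd_inner_matrix_zero:
  fixes t :: "complex^'r^'d"
  assumes N: "adj N = N" and psd: "\<And>x. 0 \<le> x \<bullet> (N *v x)" and t: "t \<bullet> (N ** t) = 0"
  shows "N ** t = 0"
proof -
  have "column c t \<bullet> (N *v column c t) = 0" for c
    using t unfolding inner_matrix_columns column_matrix_mult
    by (subst (asm) sum_nonneg_eq_0_iff) (auto intro: psd)
  then have "column c (N ** t) = 0" for c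
    unfolding column_matrix_mult by (rule psd_kernel[OF N psd])
  then show ?thesis by (simp add: vec_eq_iff column_def)
qed

lemma pos_def_lower_bound:
  assumes "pos_def (G :: complex^'n^'n)"
  obtains c where "c > 0" "\<And>x. c * (x \<bullet> x) \<le> x \<bullet> (G *v x)"
proof -
  obtain U :: "complex^'n^'n" and l where U: "adj U ** U = mat 1" "U ** adj U = mat 1"
    and G: "G = U ** diag l ** adj U" and l: "\<And>i. l i > 0"
    using pos_def_spectral[OF assms] by metis
  define c where "c = Min (range l)"
  have "c > 0" using l by (simp add: c_def)
  moreover have "c * (x \<bullet> x) \<le> x \<bullet> (G *v x)" for x
  proof -
    have "x \<bullet> x = x \<bullet> ((U ** diag (\<lambda>_. 1) ** adj U) *v x)" by (simp add: diag_one U)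
    then have "c * (x \<bullet> x) = (\<Sum>i\<in>UNIV. c * (norm ((adj U *v x) $ i))\<^sup>2)"
      by (simp add: conj_diag_inner sum_distrib_left)
    also have "\<dots> \<le> x \<bullet> (G *v x)"
      unfolding G conj_diag_inner by (intro sum_mono mult_right_mono) (auto simp: c_def)
    finally show ?thesis .
  qed
  ultimately show ?thesis by (rule that)
qed

lemma norm_adj_vector_le: "norm (adj t *v x) \<le> norm t * norm x" for t :: "complex^'r^'d"
  using norm_matrix_vector_le[of "adj t" x] by (simp add: norm_adj)

lemma borel_measurable_weighted_form [measurable]:
  "(\<lambda>t :: complex^'r^'d. (norm (adj t *v x))\<^sup>2 / (t \<bullet> (G ** t))) \<in> borel_measurable borel"
  by (intro borel_measurable_divide borel_measurable_continuous_onI continuous_intros)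

text \<open>Numerator and denominator both scale like \<open>(norm t)\<^sup>2\<close>, so the bound
  is uniform in \<open>t\<close> and gives integrability on any finite measure.\<close>

lemma weighted_form_le:
  fixes t :: "complex^'r^'d"
  assumes c: "c > 0" "\<And>x. c * (x \<bullet> x) \<le> x \<bullet> (G *v x)"
  shows "0 \<le> (norm (adj t *v x))\<^sup>2 / (t \<bullet> (G ** t))" "(norm (adj t *v x))\<^sup>2 / (t \<bullet> (G ** t)) \<le> (norm x)\<^sup>2 / c"
proof -
  have G: "c * (norm t)\<^sup>2 \<le> t \<bullet> (G ** t)" by (rule inner_matrix_lower_bound[OF c(2)])
  then have "0 \<le> t \<bullet> (G ** t)" using c(1) by (meson mult_nonneg_nonneg less_imp_le order_trans zero_le_power2)
  then show "0 \<le> (norm (adj t *v x))\<^sup>2 / (t \<bullet> (G ** t))" by simp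
  show "(norm (adj t *v x))\<^sup>2 / (t \<bullet> (G ** t)) \<le> (norm x)\<^sup>2 / c"
  proof (cases "t = 0")
    case False
    then have t: "c * (norm t)\<^sup>2 > 0" using c by simp
    have "(norm (adj t *v x))\<^sup>2 / (t \<bullet> (G ** t)) \<le> (norm t * norm x)\<^sup>2 / (c * (norm t)\<^sup>2)"
      using t G by (intro frac_le power_mono norm_adj_vector_le) auto
    also have "\<dots> = (norm x)\<^sup>2 / c" using False by (simp add: power_mult_distrib)
    finally show ?thesis .
  qed (use c in auto)
qed

text \<open>With \<open>\<mu>\<close> the largest generalised eigenvalue of \<open>(G2, G1)\<close>, the matrix \<open>N = \<mu> G1 - G2\<close> is
  semidefinite and \<open>N y = 0\<close> for some \<open>y \<noteq> 0\<close>. Testing both fixed point equations at \<open>G2 y = \<mu> G1 y\<close>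
  forces almost every \<open>T\<close> to be orthogonal to this vector or to the range of \<open>N\<close>.\<close>

lemma fixed_point_unique:
  fixes T :: "'a \<Rightarrow> complex^'r^'d" and G1 G2 :: "complex^'d^'d"
  assumes "finite_measure M" and T [measurable]: "T \<in> borel_measurable M" and "C > 0"
    and G1: "pos_def G1" "Re (trace G1) = 1"
    and G2: "pos_def G2" "Re (trace G2) = 1"
    and fix1: "\<And>x. x \<bullet> (matrix_inv G1 *v x) = C * (LINT \<omega>|M. (norm (adj (T \<omega>) *v x))\<^sup>2 / (T \<omega> \<bullet> (G1 ** T \<omega>)))"
    and fix2: "\<And>x. x \<bullet> (matrix_inv G2 *v x) = C * (LINT \<omega>|M. (norm (adj (T \<omega>) *v x))\<^sup>2 / (T \<omega> \<bullet> (G2 ** T \<omega>)))"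
    and nondeg: "\<And>v w. v \<noteq> 0 \<Longrightarrow> w \<noteq> 0 \<Longrightarrow> \<not> (AE \<omega> in M. adj (T \<omega>) *v v = 0 \<or> adj (T \<omega>) *v w = 0)"
  shows "G1 = G2"
proof -
  interpret finite_measure M by fact
  have pos: "0 < x \<bullet> (G1 *v x)" "0 < x \<bullet> (G2 *v x)" if "x \<noteq> 0" for x
    using G1(1) G2(1) that by (auto simp: pos_def_iff)
  \<comment> \<open>Generalised Rayleigh quotient. It is invariant under real scaling of
    \<open>x\<close>, so its maximum on the sphere bounds it at every nonzero vector.\<close>
  define f where "f x = (x \<bullet> (G2 *v x)) / (x \<bullet> (G1 *v x))" for x
  have "\<forall>x\<in>sphere 0 1. x \<bullet> (G1 *v x) \<noteq> 0"
  proof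
    fix x :: "complex^'d" assume "x \<in> sphere 0 1"
    then have "x \<noteq> 0" by auto
    from pos(1)[OF this] show "x \<bullet> (G1 *v x) \<noteq> 0" by simp
  qed
  then have "continuous_on (sphere 0 1) f"
    unfolding f_def by (intro continuous_intros)
  moreover have "axis undefined 1 \<in> sphere (0 :: complex^'d) 1" by (simp add: norm_eq_sqrt_inner inner_axis_axis)
  ultimately obtain y where "norm y = 1" and max: "\<And>x. norm x = 1 \<Longrightarrow> f x \<le> f y"
    using continuous_attains_sup[of "sphere 0 1" f] compact_sphere by (metis empty_iff dist_0_norm mem_sphere)
  then have y: "y \<noteq> 0" by auto
  define \<mu> where "\<mu> = f y"
  have \<mu>: "\<mu> > 0" using pos[OF y] by (simp add: \<mu>_def f_def)
  define N where "N = \<mu> *\<^sub>R G1 - G2"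
  have N: "adj N = N"
    using G1 G2 by (simp add: N_def adj_diff adj_scaleR pos_def_adj)
  have Nx: "x \<bullet> (N *v x) = \<mu> * (x \<bullet> (G1 *v x)) - x \<bullet> (G2 *v x)" for x
    by (simp add: N_def matrix_vector_mult_diff_rdistrib scaleR_matrix_vector inner_diff_right)
  have psd: "0 \<le> x \<bullet> (N *v x)" for x
  proof (cases "x = 0")
    case False
    have "f ((1 / norm x) *\<^sub>R x) = f x"
      using False by (simp add: f_def matrix_vector_scaleR)
    moreover have "f ((1 / norm x) *\<^sub>R x) \<le> \<mu>" unfolding \<mu>_def by (rule max) (use False in simp)
    ultimately have "f x \<le> \<mu>" by simp
    then show ?thesis using pos[OF False] by (simp add: Nx f_def divide_le_eq)
  qed simp
  have "y \<bullet> (N *v y) = 0" using pos[OF y] by (simp add: Nx \<mu>_def f_def)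
  then have Ny: "N *v y = 0" by (rule psd_kernel[OF N psd])
  define v where "v = G2 *v y"
  have v1: "v = \<mu> *\<^sub>R (G1 *v y)"
    using Ny by (simp add: v_def N_def matrix_vector_mult_diff_rdistrib scaleR_matrix_vector)
  have vy: "v \<bullet> y > 0" using pos(2)[OF y] by (simp add: v_def inner_commute)
  have "N = 0"
  proof (rule ccontr)
    assume "N \<noteq> 0"
    then obtain e where e: "N *v e \<noteq> 0" by (metis matrix_eq matrix_vector_mult_0)
    define g where "g G = (\<lambda>\<omega>. (norm (adj (T \<omega>) *v v))\<^sup>2 / (T \<omega> \<bullet> (G ** T \<omega>)))" for G
    have int: "integrable M (g G)" if G: "pos_def G" for G
    proof -
      obtain c where c: "c > 0" "\<And>x. c * (x \<bullet> x) \<le> x \<bullet> (G *v x)" using pos_def_lower_bound[OF G] by metis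
      have "g G \<in> borel_measurable M" unfolding g_def by measurable
      moreover have "norm (g G \<omega>) \<le> (norm v)\<^sup>2 / c" for \<omega>
        using weighted_form_le[OF c, where t = "T \<omega>" and x = v]
        unfolding g_def real_norm_def by (simp only: abs_of_nonneg)
      ultimately show ?thesis
        by (intro integrable_const_bound[where B = "(norm v)\<^sup>2 / c"]) auto
    qed
    have inv: "matrix_inv G2 *v v = y" "matrix_inv G1 *v v = \<mu> *\<^sub>R y"
      by (simp add: v_def matrix_vector_mul_assoc pos_def_inv_left[OF G2(1)])
         (simp add: v1 matrix_vector_scaleR matrix_vector_mul_assoc pos_def_inv_left[OF G1(1)])
    \<comment> \<open>Either inverse maps \<open>v\<close> to a multiple of \<open>y\<close>, so
      both integrals are known and agree after division by \<open>\<mu>\<close>.\<close>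
    have "C * integral\<^sup>L M (g G2) = v \<bullet> y" "C * integral\<^sup>L M (g G1) = \<mu> * (v \<bullet> y)"
      using fix1[of v] fix2[of v] by (simp_all only: g_def inv inner_scaleR_right)
    then have "C * (integral\<^sup>L M (g G2) - integral\<^sup>L M (g G1) / \<mu>) = 0"
      using \<mu> by (simp add: right_diff_distrib)
    then have eq: "integral\<^sup>L M (g G2) - integral\<^sup>L M (g G1) / \<mu> = 0" using \<open>C > 0\<close> by simp
    have NT: "t \<bullet> (N ** t) = \<mu> * (t \<bullet> (G1 ** t)) - t \<bullet> (G2 ** t)" for t :: "complex^'r^'d"
      by (simp add: N_def matrix_mult_diff_left matrix_mult_scaleR_left inner_diff_right)
    have pos': "0 < T \<omega> \<bullet> (G1 ** T \<omega>)" "0 < T \<omega> \<bullet> (G2 ** T \<omega>)" if "T \<omega> \<noteq> 0" for \<omega>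
      using that by (auto intro: pos_def_inner_matrix_pos G1 G2)
    \<comment> \<open>Semidefiniteness of \<open>N\<close> orders the denominators and hence the
      integrands pointwise; with equal integrals they agree almost everywhere.\<close>
    have nn: "0 \<le> g G2 \<omega> - g G1 \<omega> / \<mu>" for \<omega>
    proof (cases "T \<omega> = 0")
      case False
      have "0 \<le> T \<omega> \<bullet> (N ** T \<omega>)"
        using inner_matrix_lower_bound[of 0 N "T \<omega>"] psd by simp
      then have "g G1 \<omega> / \<mu> \<le> g G2 \<omega>"
        unfolding g_def NT divide_divide_eq_left
        using \<mu> pos'[OF False] by (intro divide_left_mono) (auto simp: mult_ac)
      then show ?thesis by simp
    qed (simp add: g_def)
    have "AE \<omega> in M. g G2 \<omega> - g G1 \<omega> / \<mu> = 0"
      using eq nn by (subst integral_nonneg_eq_0_iff_AE[symmetric]) (auto simp: int G1 G2)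
    then have "AE \<omega> in M. adj (T \<omega>) *v v = 0 \<or> adj (T \<omega>) *v (N *v e) = 0"
    proof (rule eventually_mono)
      fix \<omega> assume 0: "g G2 \<omega> - g G1 \<omega> / \<mu> = 0"
      show "adj (T \<omega>) *v v = 0 \<or> adj (T \<omega>) *v (N *v e) = 0"
      proof (cases "adj (T \<omega>) *v v = 0")
        case nz: False
        then have "T \<omega> \<noteq> 0" by auto
        from pos'[OF this] 0 nz \<mu> have "T \<omega> \<bullet> (N ** T \<omega>) = 0"
          unfolding NT g_def by (simp add: field_simps)
        then have "N ** T \<omega> = 0" by (rule psd_inner_matrix_zero[OF N psd])
        then have "adj (T \<omega>) ** N = 0" by (metis N adj_mult adj_zero)
        then show ?thesis by (simp add: matrix_vector_mul_assoc)
      qed simp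
    qed
    moreover have "v \<noteq> 0" using vy by auto
    ultimately show False using nondeg e by blast
  qed
  then have eq: "\<mu> *\<^sub>R G1 = G2" by (simp add: N_def)
  then have "\<mu> = 1" using G1(2) G2(2) by (auto simp: trace_scaleR)
  with eq show ?thesis by simp
qed

section \<open>The iteration for a fixed sample\<close>

text \<open>The \<open>S G\<close> of the overview. For positive definite \<open>G\<close>,
  conjugating it by \<open>psd_sqrt G\<close> gives \<open>M_mat\<close>.\<close>

definition weighted_cov :: "nat \<Rightarrow> (nat \<Rightarrow> complex^'r^'d) \<Rightarrow> complex^'d^'d \<Rightarrow> complex^'d^'d" where
  "weighted_cov n Ts G = (real CARD('d) / real n) *\<^sub>R
     (\<Sum>j<n. (1 / (Ts j \<bullet> (G ** Ts j))) *\<^sub>R (Ts j ** adj (Ts j)))"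

lemma trace_adj_mult_real:
  assumes "adj G = G"
  shows "trace (adj t ** G ** t) = of_real (t \<bullet> (G ** t))"
proof -
  have "trace (adj t ** G ** t) = of_real (Re (trace (adj t ** G ** t)))"
    by (rule trace_selfadjoint) (simp add: adj_mult assms matrix_mul_assoc)
  then show ?thesis
    by (simp add: Re_trace_adj_mult flip: matrix_mul_assoc)
qed

lemma M_mat_eq:
  assumes "pos_def G"
  shows "M_mat n Ts G = psd_sqrt G ** weighted_cov n Ts G ** psd_sqrt G"
proof -
  define R where "R = psd_sqrt G"
  have s: "mscale (1 / trace (adj t ** G ** t)) A = (1 / (t \<bullet> (G ** t))) *\<^sub>R A" for A t
    by (simp add: trace_adj_mult_real[OF pos_def_adj[OF assms]] flip: mscale_of_real)
  have "mscale (of_nat CARD('a) / of_nat n) A = (real CARD('a) / real n) *\<^sub>R A" for A :: "complex^'a^'a"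
    by (simp flip: mscale_of_real)
  then show ?thesis
    unfolding M_mat_def s weighted_cov_def R_def[symmetric]
    by (simp add: matrix_mult_scaleR_left matrix_mult_scaleR_right matrix_mult_sum_left matrix_mult_sum_right
        matrix_mul_assoc)
qed

text \<open>With \<open>R = psd_sqrt G\<close>, inverting \<open>R ** S ** R\<close> and conjugating
  by \<open>R\<close> cancels the square roots; in the trace they cancel by cyclicity.\<close>

lemma iter_step_eq:
  assumes G: "pos_def G" and S: "pos_def (weighted_cov n Ts G)"
  shows "iter_step n Ts G = (1 / Re (trace (matrix_inv (weighted_cov n Ts G)))) *\<^sub>R matrix_inv (weighted_cov n Ts G)"
proof -
  define R where "R = psd_sqrt G"
  define S where "S = weighted_cov n Ts G"
  have R: "pos_def R" "R ** R = G" by (simp_all add: R_def psd_sqrt[OF G])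
  note inv = pos_def_inv_left[OF R(1)] pos_def_inv_right[OF R(1)]
    pos_def_inv_left[OF assms(2)[folded S_def]] pos_def_inv_right[OF assms(2)[folded S_def]]
  define P where "P = matrix_inv R"
  define Q where "Q = matrix_inv S"
  note inv = inv[folded P_def Q_def]
  have PR: "X ** P ** R = X" "X ** R ** P = X" "X ** S ** Q = X" "X ** Q ** S = X" for X
    by (simp_all add: inv flip: matrix_mul_assoc)
  have M: "matrix_inv (M_mat n Ts G) = P ** Q ** P"
    unfolding M_mat_eq[OF G] R_def[symmetric] S_def[symmetric]
    by (rule matrix_inv_unique) (simp_all add: matrix_mul_assoc PR inv)
  have Q: "R ** (P ** Q ** P) ** R = Q"
    by (simp add: matrix_mul_assoc inv PR)
  have "trace (G ** (P ** Q ** P)) = trace (R ** (P ** Q ** P) ** R)"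
    unfolding R(2)[symmetric] matrix_mul_assoc[symmetric] by (subst trace_mult_commute) (simp add: matrix_mul_assoc)
  also have "\<dots> = of_real (Re (trace Q))"
    unfolding Q by (rule trace_selfadjoint) (simp add: Q_def pos_def_adj pos_def_matrix_inv assms S_def)
  finally have "1 / trace (G ** (P ** Q ** P)) = of_real (1 / Re (trace Q))" by simp
  then show ?thesis
    unfolding iter_step_def M Q R_def[symmetric] S_def[symmetric] Q_def[symmetric]
    by (simp only: mscale_of_real)
qed

text \<open>Otherwise a subsequence stays away from \<open>L\<close>, and compactness gives it a
  limit point different from \<open>L\<close>. Serves both for the iterates and for growing
  samples.\<close>

lemma compact_unique_limit_point:
  fixes x :: "nat \<Rightarrow> 'a :: metric_space"
  assumes K: "compact K" and x: "\<And>k. x k \<in> K"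
    and lim: "\<And>r l. strict_mono r \<Longrightarrow> (x \<circ> r) \<longlonglongrightarrow> l \<Longrightarrow> l = L"
  shows "x \<longlonglongrightarrow> L"
proof (rule ccontr)
  assume "\<not> x \<longlonglongrightarrow> L"
  then obtain e where e: "e > 0" "\<And>N. \<exists>k\<ge>N. dist (x k) L \<ge> e"
    by (auto simp: lim_sequentially not_less)
  then have "infinite {k. dist (x k) L \<ge> e}"
    by (auto simp: infinite_nat_iff_unbounded_le)
  then obtain r :: "nat \<Rightarrow> nat" where r: "strict_mono r" "\<And>k. dist (x (r k)) L \<ge> e"
    using infinite_enumerate by (metis mem_Collect_eq)
  obtain l s where s: "strict_mono s" "((x \<circ> r) \<circ> s) \<longlonglongrightarrow> l"
    using K x unfolding compact_def by (metis comp_apply)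
  then have l: "(x \<circ> (r \<circ> s)) \<longlonglongrightarrow> l" by (simp add: comp_assoc)
  then have "l = L" using r(1) s(1) by (intro lim[OF strict_mono_o])
  with l have "(\<lambda>k. dist (x (r (s k))) L) \<longlonglongrightarrow> dist L L"
    by (intro tendsto_intros) (simp add: comp_def)
  then have "e \<le> dist L L" by (rule LIMSEQ_le_const) (use r in auto)
  then show False using e by simp
qed

text \<open>The trace bounds these matrices and, for \<open>c > 0\<close>, the lower bound on the
  form keeps them away from singular ones: this is the compact set of the overview.\<close>

definition trace_one_ge :: "real \<Rightarrow> (complex^'n^'n) set" where
  "trace_one_ge c = {G. adj G = G \<and> Re (trace G) = 1 \<and> (\<forall>x. c * (x \<bullet> x) \<le> x \<bullet> (G *v x))}"

lemma trace_one_ge_pos_def: "c > 0 \<Longrightarrow> G \<in> trace_one_ge c \<Longrightarrow> pos_def G"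
  by (auto simp: trace_one_ge_def pos_def_iff) (metis inner_gt_zero_iff mult_pos_pos less_le_trans)

lemma compact_trace_one_ge:
  assumes "c > 0"
  shows "compact (trace_one_ge c :: (complex^'n^'n) set)"
  unfolding compact_eq_bounded_closed
proof
  obtain K where "\<And>A :: complex^'n^'n. pos_def A \<Longrightarrow> Re (trace A) = 1 \<Longrightarrow> norm A \<le> K"
    using norm_le_if_trace_1 by blast
  moreover have "pos_def G \<and> Re (trace G) = 1" if "G \<in> trace_one_ge c" for G :: "complex^'n^'n"
    using trace_one_ge_pos_def[OF assms that] that by (simp add: trace_one_ge_def)
  ultimately show "bounded (trace_one_ge c :: (complex^'n^'n) set)"
    by (auto simp: bounded_iff)
  show "closed (trace_one_ge c :: (complex^'n^'n) set)"
    unfolding trace_one_ge_def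
    by (intro closed_Collect_conj closed_Collect_all closed_Collect_eq closed_Collect_le continuous_intros)
qed

text \<open>The slab condition, relative to the size of each \<open>Ts j\<close>. The bound
  \<open>\<epsilon> \<le> 1\<close> makes \<open>ln (\<epsilon>\<^sup>2 / CARD('d))\<close>
  nonpositive, as the estimate in \<open>coercive\<close> requires.\<close>

locale spread_sample =
  fixes n :: nat and Ts :: "nat \<Rightarrow> complex^'r^'d" and \<epsilon> :: real
  assumes n: "n > 0" and eps: "0 < \<epsilon>" "\<epsilon> \<le> 1"
    and nonzero: "\<And>j. j < n \<Longrightarrow> Ts j \<noteq> 0"
    and spread: "\<And>v. norm v = 1 \<Longrightarrow>
      2 * CARD('d) * card {j. j < n \<and> norm (adj (Ts j) *v v) < \<epsilon> * norm (Ts j)} < n"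
begin

abbreviation S where "S \<equiv> weighted_cov n Ts"

text \<open>For \<open>r = 1\<close>, up to a factor and an additive constant, the objective of
  Tyler's scatter estimator as a function of the inverse scatter matrix. Dividing by
  \<open>(norm (Ts j))\<^sup>2\<close> makes it vanish at the identity, so the iteration starts at
  level 0.\<close>

definition potential :: "complex^'d^'d \<Rightarrow> real" where
  "potential G = (\<Sum>j<n. ln ((Ts j \<bullet> (G ** Ts j)) / (norm (Ts j))\<^sup>2)) / n - ln (Re (det G)) / CARD('d)"

text \<open>The eigenvalue bound that comes out of \<open>coercive\<close>. It depends on slab width
  and dimension, hence is common to all sample sizes.\<close>

definition lower :: real where "lower = (\<epsilon>\<^sup>2 / CARD('d)) ^ (2 * CARD('d))"

lemma lower_pos: "lower > 0"
  using eps by (simp add: lower_def)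

lemma form_pos: "pos_def G \<Longrightarrow> j < n \<Longrightarrow> 0 < Ts j \<bullet> (G ** Ts j)"
  by (rule pos_def_inner_matrix_pos) (auto simp: nonzero)

text \<open>Since \<open>2 * CARD('d)\<close> is at least 2, each vector is orthogonal to fewer than
  half of the samples, and two such index sets cannot cover \<open>{..<n}\<close>.\<close>

lemma ex_nonorthogonal:
  assumes "v \<noteq> 0" "w \<noteq> 0"
  shows "\<exists>j<n. adj (Ts j) *v v \<noteq> 0 \<and> adj (Ts j) *v w \<noteq> 0"
proof -
  have card: "2 * card {j. j < n \<and> adj (Ts j) *v v = 0} < n" if "v \<noteq> 0" for v
  proof -
    define u where "u = (1 / norm v) *\<^sub>R v"
    let ?B = "{j. j < n \<and> norm (adj (Ts j) *v u) < \<epsilon> * norm (Ts j)}"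
    have "card {j. j < n \<and> adj (Ts j) *v v = 0} \<le> card ?B"
      by (rule card_mono) (use that nonzero eps in \<open>auto simp: u_def matrix_vector_scaleR\<close>)
    moreover have "2 \<le> 2 * CARD('d)" by (simp add: Suc_le_eq)
    ultimately have "2 * card {j. j < n \<and> adj (Ts j) *v v = 0} \<le> 2 * CARD('d) * card ?B"
      by (intro mult_le_mono)
    also have "\<dots> < n"
      by (rule spread) (use that in \<open>simp add: u_def\<close>)
    finally show ?thesis .
  qed
  have "card ({j. j < n \<and> adj (Ts j) *v v = 0} \<union> {j. j < n \<and> adj (Ts j) *v w = 0}) < n"
    using card_Un_le[of "{j. j < n \<and> adj (Ts j) *v v = 0}" "{j. j < n \<and> adj (Ts j) *v w = 0}"]
      card[OF assms(1)] card[OF assms(2)] by linarith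
  then have "{j. j < n \<and> adj (Ts j) *v v = 0} \<union> {j. j < n \<and> adj (Ts j) *v w = 0} \<noteq> {..<n}"
    by (metis card_lessThan less_irrefl)
  then show ?thesis by auto
qed

lemma inner_weighted_cov:
  "x \<bullet> (S G *v x) = real CARD('d) / n * (\<Sum>j<n. (norm (adj (Ts j) *v x))\<^sup>2 / (Ts j \<bullet> (G ** Ts j)))"
proof -
  have 1: "(\<Sum>j\<in>J. B j) *v x = (\<Sum>j\<in>J. B j *v x)" for B :: "nat \<Rightarrow> complex^'d^'d" and J
    by (induction J rule: infinite_finite_induct) (simp_all add: matrix_vector_mult_add_rdistrib)
  have "x \<bullet> ((Ts j ** adj (Ts j)) *v x) = (norm (adj (Ts j) *v x))\<^sup>2" for j
    using inner_adj_right[of x "Ts j" "adj (Ts j) *v x"]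
    by (simp add: matrix_vector_mul_assoc power2_norm_eq_inner)
  then show ?thesis
    by (simp add: weighted_cov_def scaleR_matrix_vector 1 inner_sum_right)
qed

lemma pos_def_weighted_cov:
  assumes "pos_def G"
  shows "pos_def (S G)"
  unfolding pos_def_iff
proof (intro conjI allI impI)
  show "adj (S G) = S G"
    by (simp add: weighted_cov_def adj_scaleR adj_sum adj_mult)
  fix x :: "complex^'d" assume "x \<noteq> 0"
  then obtain j where j: "j < n" "adj (Ts j) *v x \<noteq> 0" using ex_nonorthogonal by blast
  then have "0 < (norm (adj (Ts j) *v x))\<^sup>2 / (Ts j \<bullet> (G ** Ts j))"
    using form_pos[OF assms] by simp
  also have "\<dots> \<le> (\<Sum>j<n. (norm (adj (Ts j) *v x))\<^sup>2 / (Ts j \<bullet> (G ** Ts j)))"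
    by (rule member_le_sum) (auto simp: j intro!: divide_nonneg_pos form_pos assms)
  finally show "0 < x \<bullet> (S G *v x)"
    unfolding inner_weighted_cov using n by simp
qed

lemma trace_mult_weighted_cov:
  "Re (trace (P ** S G)) = real CARD('d) / n * (\<Sum>j<n. (Ts j \<bullet> (P ** Ts j)) / (Ts j \<bullet> (G ** Ts j)))"
proof -
  have "Re (trace (P ** (t ** adj t))) = t \<bullet> (P ** t)" for t :: "complex^'r^'d"
    by (simp add: Re_trace_adj_mult[symmetric] matrix_mul_assoc) (simp add: trace_mult_commute[of _ "adj t"] matrix_mul_assoc)
  then show ?thesis
    by (simp add: weighted_cov_def matrix_mult_scaleR_right matrix_mult_sum_right trace_scaleR trace_sum)
qed

text \<open>The factor d/n in \<open>S\<close> is there for this normalisation, under which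
  \<open>det_le_one\<close> applies.\<close>

lemma trace_mult_weighted_cov_self:
  assumes "pos_def G"
  shows "Re (trace (G ** S G)) = CARD('d)"
proof -
  have "(\<Sum>j<n. (Ts j \<bullet> (G ** Ts j)) / (Ts j \<bullet> (G ** Ts j))) = (\<Sum>j<n. 1)"
    by (rule sum.cong) (auto simp: form_pos[OF assms] less_imp_neq[symmetric])
  then show ?thesis using n by (simp add: trace_mult_weighted_cov)
qed

text \<open>The matrix \<open>R ** S G ** R\<close> with \<open>R = psd_sqrt G\<close> is positive
  definite with trace d, so \<open>det_le_one\<close> applies to it; the equality case is the fixed
  point equation.\<close>

lemma det_product:
  assumes G: "pos_def G"
  shows ln_det_product_nonpos: "ln (Re (det G) * Re (det (S G))) \<le> 0"
    and det_product_eq_one: "Re (det G) * Re (det (S G)) = 1 \<Longrightarrow> G ** S G = mat 1"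
proof -
  define R where "R = psd_sqrt G"
  have R: "pos_def R" "R ** R = G" by (simp_all add: R_def psd_sqrt[OF G])
  have pd: "pos_def (R ** S G ** R)" by (rule pos_def_sandwich[OF R(1) pos_def_weighted_cov[OF G]])
  have "trace (R ** S G ** R) = trace (R ** R ** S G)"
    by (subst trace_mult_commute) (simp add: matrix_mul_assoc)
  then have tr: "Re (trace (R ** S G ** R)) = CARD('d)"
    by (simp add: R trace_mult_weighted_cov_self[OF G])
  have "det (R ** S G ** R) = det (R ** R ** S G)"
    by (simp add: det_mul mult_ac)
  then have det: "Re (det (R ** S G ** R)) = Re (det G) * Re (det (S G))"
    unfolding R(2) by (simp add: pos_def_det_mult G pos_def_weighted_cov)
  show "ln (Re (det G) * Re (det (S G))) \<le> 0"
    using ln_det_nonpos[OF pd tr] by (simp add: det)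
  assume "Re (det G) * Re (det (S G)) = 1"
  then have "R ** S G ** R = mat 1" using det_one_imp_mat_1[OF pd tr] by (simp add: det)
  then have "R ** (R ** S G) = mat 1" by (simp add: matrix_left_right_inverse_complex)
  then show "G ** S G = mat 1" by (simp add: matrix_mul_assoc R)
qed

text \<open>Both parts of the potential grow by \<open>ln c\<close>, so the trace normalisation in
  the iteration does not change it.\<close>

lemma potential_scaleR:
  assumes "c > 0" "pos_def G"
  shows "potential (c *\<^sub>R G) = potential G"
proof -
  have "(\<Sum>j<n. ln ((Ts j \<bullet> ((c *\<^sub>R G) ** Ts j)) / (norm (Ts j))\<^sup>2)) = (\<Sum>j<n. ln c + ln ((Ts j \<bullet> (G ** Ts j)) / (norm (Ts j))\<^sup>2))"
  proof (rule sum.cong)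
    fix j assume "j \<in> {..<n}"
    then have "(Ts j \<bullet> (G ** Ts j)) / (norm (Ts j))\<^sup>2 > 0"
      using form_pos[OF assms(2)] nonzero by simp
    then show "ln ((Ts j \<bullet> ((c *\<^sub>R G) ** Ts j)) / (norm (Ts j))\<^sup>2) = ln c + ln ((Ts j \<bullet> (G ** Ts j)) / (norm (Ts j))\<^sup>2)"
      using assms(1) ln_mult_pos[of c "(Ts j \<bullet> (G ** Ts j)) / (norm (Ts j))\<^sup>2"]
      by (simp add: matrix_mult_scaleR_left)
  qed simp
  then show ?thesis
    using n assms pos_def_det_pos[OF assms(2)]
    by (simp add: potential_def pos_def_det_scaleR sum.distrib add_divide_distrib ln_mult ln_realpow)
qed

text \<open>The iteration is a majorise-minimise scheme: \<open>ln y \<le> y - 1\<close> linearises the logarithmic part of the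
  potential, and the next iterate minimises the resulting majorant.\<close>

lemma potential_descent:
  assumes G: "pos_def G"
  shows "potential (iter_step n Ts G) \<le> potential G + ln (Re (det G) * Re (det (S G))) / CARD('d)"
proof -
  note SG = pos_def_weighted_cov[OF G]
  define P where "P = matrix_inv (S G)"
  have P: "pos_def P" "P ** S G = mat 1"
    by (simp_all add: P_def pos_def_matrix_inv pos_def_inv_left SG)
  have "potential (iter_step n Ts G) = potential P"
    unfolding iter_step_eq[OF G SG] P_def[symmetric]
    by (rule potential_scaleR) (simp_all add: P pos_def_trace_pos)
  also have "\<dots> \<le> potential G + ln (Re (det G) * Re (det (S G))) / CARD('d)"
  proof -
    define y where "y j = (Ts j \<bullet> (P ** Ts j)) / (Ts j \<bullet> (G ** Ts j))" for j
    \<comment> \<open>As \<open>P\<close> inverts \<open>S G\<close>, the ratios \<open>y j\<close>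
      average to 1 and the linear terms \<open>y j - 1\<close> cancel in the sum.\<close>
    have "real CARD('d) / n * (\<Sum>j<n. y j) = CARD('d)"
      using trace_mult_weighted_cov[of P G] by (simp add: P y_def trace_def mat_def)
    then have y: "(\<Sum>j<n. y j - 1) = 0" using n by (simp add: sum_subtractf field_simps)
    have "ln ((Ts j \<bullet> (P ** Ts j)) / (norm (Ts j))\<^sup>2) \<le> ln ((Ts j \<bullet> (G ** Ts j)) / (norm (Ts j))\<^sup>2) + (y j - 1)"
      if "j < n" for j
    proof -
      have pos: "Ts j \<bullet> (P ** Ts j) > 0" "Ts j \<bullet> (G ** Ts j) > 0" "(norm (Ts j))\<^sup>2 > 0"
        using that form_pos G P nonzero by auto
      then have "ln (y j) \<le> y j - 1" unfolding y_def by (intro ln_le_minus_one divide_pos_pos)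
      moreover have "ln (y j) = ln ((Ts j \<bullet> (P ** Ts j)) / (norm (Ts j))\<^sup>2) - ln ((Ts j \<bullet> (G ** Ts j)) / (norm (Ts j))\<^sup>2)"
        using pos by (simp add: y_def ln_div)
      ultimately show ?thesis by simp
    qed
    then have "(\<Sum>j<n. ln ((Ts j \<bullet> (P ** Ts j)) / (norm (Ts j))\<^sup>2))
        \<le> (\<Sum>j<n. ln ((Ts j \<bullet> (G ** Ts j)) / (norm (Ts j))\<^sup>2) + (y j - 1))"
      by (intro sum_mono) auto
    also have "\<dots> = (\<Sum>j<n. ln ((Ts j \<bullet> (G ** Ts j)) / (norm (Ts j))\<^sup>2))"
      using y by (simp add: sum.distrib)
    finally have 1: "(\<Sum>j<n. ln ((Ts j \<bullet> (P ** Ts j)) / (norm (Ts j))\<^sup>2)) / n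
        \<le> (\<Sum>j<n. ln ((Ts j \<bullet> (G ** Ts j)) / (norm (Ts j))\<^sup>2)) / n"
      by (rule divide_right_mono) simp
    have "Re (det P) * Re (det (S G)) = 1"
      using pos_def_det_mult[OF P(1) SG] by (simp add: P)
    then have "ln (Re (det P)) + ln (Re (det (S G))) = 0"
      using pos_def_det_pos[OF P(1)] pos_def_det_pos[OF SG] by (metis ln_mult_pos ln_one)
    then have "- ln (Re (det P)) = - ln (Re (det G)) + ln (Re (det G) * Re (det (S G)))"
      using pos_def_det_pos[OF G] pos_def_det_pos[OF SG] by (simp add: ln_mult)
    then have "- ln (Re (det P)) / CARD('d) = - ln (Re (det G)) / CARD('d) + ln (Re (det G) * Re (det (S G))) / CARD('d)"
      by (metis add_divide_distrib)
    with 1 show ?thesis unfolding potential_def by simp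
  qed
  finally show ?thesis .
qed

lemma iter_step_pos_def:
  assumes "pos_def G"
  shows "pos_def (iter_step n Ts G)" "Re (trace (iter_step n Ts G)) = 1"
proof -
  note SG = pos_def_weighted_cov[OF assms]
  note tr = pos_def_trace_pos[OF pos_def_matrix_inv[OF SG]]
  show "pos_def (iter_step n Ts G)"
    unfolding iter_step_eq[OF assms SG] by (rule pos_def_scaleR) (use tr pos_def_matrix_inv[OF SG] in auto)
  show "Re (trace (iter_step n Ts G)) = 1"
    unfolding iter_step_eq[OF assms SG] using tr by (simp add: trace_scaleR)
qed

end

section \<open>Coercivity of the potential and convergence of the iterates\<close>

lemma norm_adj_mult_nth: "norm ((adj U ** t) $ i) = norm (adj t *v column i U)"
proof -
  have "(adj t *v column i U) $ c = cnj ((adj U ** t) $ i $ c)" for c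
    by (simp add: matrix_vector_mult_def matrix_matrix_mult_def column_def mult.commute)
  then show ?thesis by (simp add: norm_vec_def)
qed

lemma pos_def_mat_1: "pos_def (mat 1)"
  by (simp add: pos_def_iff)

context spread_sample
begin

text \<open>The top eigenvalue is at least 1/d, so samples outside the slab of its eigenvector
  contribute at least \<open>ln \<delta>\<close>. The others contribute at least
  \<open>ln (l k)\<close>, with \<open>l k\<close> the least eigenvalue, and have total weight at
  most 1/(2d). As the determinant is at most \<open>l k\<close>, a nonpositive potential forces
  \<open>ln (l k) / (2 * d) + ln \<delta> \<le> ln (l k) / d\<close>, where d is the
  dimension.\<close>

lemma coercive:
  assumes G: "pos_def G" "Re (trace G) = 1" and le: "potential G \<le> 0"
  shows "G \<in> trace_one_ge lower"
proof -
  obtain U :: "complex^'d^'d" and l where U: "adj U ** U = mat 1" "U ** adj U = mat 1"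
    and G': "G = U ** diag l ** adj U" and l: "\<And>i. l i > 0"
    using pos_def_spectral[OF G(1)] by metis
  have tr: "(\<Sum>i\<in>UNIV. l i) = 1"
    using G(2) unfolding G' trace_conj_diag[OF U(1)] Re_complex_of_real .
  have l1: "l i \<le> 1" for i
    unfolding tr[symmetric] by (rule member_le_sum) (auto simp: l less_imp_le)
  have "Max (range l) \<in> range l" "Min (range l) \<in> range l" by (simp_all add: Max_in Min_in)
  then obtain m k where mk: "l m = Max (range l)" "l k = Min (range l)" by (metis rangeE)
  have m: "l i \<le> l m" and k: "l k \<le> l i" for i
    unfolding mk by simp_all
  have "(\<Sum>i\<in>UNIV. l i) \<le> (\<Sum>i\<in>(UNIV :: 'd set). l m)" by (rule sum_mono[OF m])
  then have lm: "1 / CARD('d) \<le> l m" by (simp add: tr field_simps)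
  define u where "u = column m U"
  have "cdot u u = (adj U ** U) $ m $ m"
    by (simp add: cdot_def u_def column_def matrix_matrix_mult_def)
  then have "norm u = 1"
    unfolding U by (simp add: norm_eq_sqrt_inner inner_eq_Re_cdot mat_def)
  define bad where "bad = {j. j < n \<and> norm (adj (Ts j) *v u) < \<epsilon> * norm (Ts j)}"
  have bad: "bad \<subseteq> {..<n}" "finite bad" by (auto simp: bad_def)
  have card: "2 * CARD('d) * card bad \<le> n"
    using spread[OF \<open>norm u = 1\<close>] by (simp add: bad_def)
  define \<delta> where "\<delta> = \<epsilon>\<^sup>2 / CARD('d)"
  have eps2: "0 < \<epsilon>\<^sup>2" "\<epsilon>\<^sup>2 \<le> 1" using eps by (simp_all add: power_le_one)
  have "1 \<le> real CARD('d)" by (simp add: Suc_le_eq)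
  then have \<delta>: "0 < \<delta>" "\<delta> \<le> 1" using eps2 order_trans[of "\<epsilon>\<^sup>2" 1 "real CARD('d)"] by (auto simp: \<delta>_def divide_le_eq)
  have form: "(if j \<in> bad then ln (l k) else ln \<delta>) \<le> ln ((Ts j \<bullet> (G ** Ts j)) / (norm (Ts j))\<^sup>2)" if "j < n" for j
  proof -
    define t where "t = Ts j"
    have t: "(norm t)\<^sup>2 > 0" using nonzero[OF that] by (simp add: t_def)
    have expand: "t \<bullet> (G ** t) = (\<Sum>i\<in>UNIV. l i * (norm ((adj U ** t) $ i))\<^sup>2)"
      unfolding G' by (rule conj_diag_inner_matrix)
    have "t \<bullet> ((U ** diag (\<lambda>_. 1) ** adj U) ** t) = (\<Sum>i\<in>UNIV. 1 * (norm ((adj U ** t) $ i))\<^sup>2)"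
      by (rule conj_diag_inner_matrix)
    then have nt: "(norm t)\<^sup>2 = (\<Sum>i\<in>UNIV. (norm ((adj U ** t) $ i))\<^sup>2)"
      by (simp add: diag_one U power2_norm_eq_inner)
    have "l k * (norm t)\<^sup>2 \<le> t \<bullet> (G ** t)"
      unfolding nt expand sum_distrib_left by (intro sum_mono mult_right_mono k) simp
    then have lk: "l k \<le> (t \<bullet> (G ** t)) / (norm t)\<^sup>2" using t by (simp add: le_divide_eq)
    have "l m * (norm ((adj U ** t) $ m))\<^sup>2 \<le> t \<bullet> (G ** t)"
      unfolding expand
      by (rule member_le_sum[where f = "\<lambda>i. l i * (norm ((adj U ** t) $ i))\<^sup>2"]) (auto intro: mult_nonneg_nonneg less_imp_le[OF l])
    then have ma: "l m * (norm (adj t *v u))\<^sup>2 \<le> t \<bullet> (G ** t)"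
      by (simp add: norm_adj_mult_nth u_def)
    show ?thesis
    proof (cases "j \<in> bad")
      case True
      then show ?thesis using lk l[of k] by (auto simp: t_def)
    next
      case False
      then have "\<epsilon> * norm t \<le> norm (adj t *v u)" using that by (simp add: bad_def t_def)
      then have "(\<epsilon> * norm t)\<^sup>2 \<le> (norm (adj t *v u))\<^sup>2" using eps by (intro power_mono) auto
      then have "1 / CARD('d) * (\<epsilon> * norm t)\<^sup>2 \<le> l m * (norm (adj t *v u))\<^sup>2"
        using lm l[of m] by (intro mult_mono) auto
      also note ma
      finally have "\<delta> \<le> (t \<bullet> (G ** t)) / (norm t)\<^sup>2"
        using t by (simp add: le_divide_eq \<delta>_def power_mult_distrib)
      then show ?thesis using False \<delta> by (simp add: t_def)
    qed
  qed
  have "(\<Sum>j<n. if j \<in> bad then ln (l k) else ln \<delta>) = card bad * ln (l k) + card ({..<n} - bad) * ln \<delta>"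
    using bad by (subst sum.If_cases) (simp_all add: Int_absorb1 flip: Diff_eq)
  \<comment> \<open>Here and in the next estimate the logarithm is nonpositive, so an upper bound on
    the count gives a lower bound on the product.\<close>
  moreover have "n / (2 * CARD('d)) * ln (l k) \<le> card bad * ln (l k)"
  proof (rule mult_right_mono_neg)
    show "real (card bad) \<le> n / (2 * CARD('d))"
      using card by (simp add: field_simps flip: of_nat_mult)
    show "ln (l k) \<le> 0" using l l1 by simp
  qed
  moreover have "n * ln \<delta> \<le> card ({..<n} - bad) * ln \<delta>"
  proof (rule mult_right_mono_neg)
    have "card ({..<n} - bad) \<le> card {..<n}" by (rule card_mono) auto
    then show "real (card ({..<n} - bad)) \<le> n" by simp
    show "ln \<delta> \<le> 0" using \<delta> by simp
  qed
  moreover have "(\<Sum>j<n. if j \<in> bad then ln (l k) else ln \<delta>) \<le> (\<Sum>j<n. ln ((Ts j \<bullet> (G ** Ts j)) / (norm (Ts j))\<^sup>2))"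
    by (rule sum_mono) (simp only: form lessThan_iff)
  ultimately have "n / (2 * CARD('d)) * ln (l k) + n * ln \<delta> \<le> (\<Sum>j<n. ln ((Ts j \<bullet> (G ** Ts j)) / (norm (Ts j))\<^sup>2))"
    by linarith
  then have "(n / (2 * CARD('d)) * ln (l k) + n * ln \<delta>) / n \<le> (\<Sum>j<n. ln ((Ts j \<bullet> (G ** Ts j)) / (norm (Ts j))\<^sup>2)) / n"
    by (rule divide_right_mono) simp
  then have avg: "ln (l k) / (2 * CARD('d)) + ln \<delta> \<le> (\<Sum>j<n. ln ((Ts j \<bullet> (G ** Ts j)) / (norm (Ts j))\<^sup>2)) / n"
    using n by (simp add: add_divide_distrib)
  have "Re (det G) = (\<Prod>i\<in>UNIV. l i)"
    by (simp only: G' det_conj_diag[OF U(1)] Re_complex_of_real)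
  also have "\<dots> = l k * (\<Prod>i\<in>UNIV - {k}. l i)"
    by (rule prod.remove) auto
  also have "\<dots> \<le> l k * 1"
    using l l1 by (intro mult_left_mono prod_le_1) (auto simp: less_imp_le)
  finally have "ln (Re (det G)) \<le> ln (l k)"
    using pos_def_det_pos[OF G(1)] by simp
  then have "ln (Re (det G)) / CARD('d) \<le> ln (l k) / CARD('d)" by (rule divide_right_mono) simp
  with avg le have "ln (l k) / (2 * CARD('d)) + ln \<delta> \<le> ln (l k) / CARD('d)"
    by (simp add: potential_def)
  then have "2 * CARD('d) * ln \<delta> \<le> ln (l k)" by (simp add: field_simps)
  moreover have "ln lower = 2 * CARD('d) * ln \<delta>"
    using \<delta> by (simp add: lower_def ln_realpow flip: \<delta>_def)
  ultimately have "ln lower \<le> ln (l k)" by simp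
  then have lower: "lower \<le> l k" using lower_pos l[of k] by simp
  have "lower * (x \<bullet> x) \<le> x \<bullet> (G *v x)" for x
  proof -
    have "x \<bullet> x = x \<bullet> ((U ** diag (\<lambda>_. 1) ** adj U) *v x)" by (simp add: diag_one U)
    then have "lower * (x \<bullet> x) = (\<Sum>i\<in>UNIV. lower * (norm ((adj U *v x) $ i))\<^sup>2)"
      by (simp add: conj_diag_inner sum_distrib_left)
    also have "\<dots> \<le> x \<bullet> (G *v x)"
      unfolding G' conj_diag_inner
      by (intro sum_mono mult_right_mono order_trans[OF lower k]) simp
    finally show ?thesis .
  qed
  then show ?thesis by (simp add: trace_one_ge_def G pos_def_adj)
qed

lemma potential_bounded_below:
  assumes "G \<in> trace_one_ge lower"
  shows "ln lower \<le> potential G"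
proof -
  have G: "pos_def G" using trace_one_ge_pos_def[OF lower_pos assms] .
  have "ln lower \<le> ln ((Ts j \<bullet> (G ** Ts j)) / (norm (Ts j))\<^sup>2)" if "j < n" for j
  proof -
    have "lower \<le> (Ts j \<bullet> (G ** Ts j)) / (norm (Ts j))\<^sup>2"
      using inner_matrix_lower_bound[of lower G "Ts j"] assms nonzero[OF that]
      by (simp add: trace_one_ge_def le_divide_eq)
    then show ?thesis using lower_pos by simp
  qed
  then have "(\<Sum>j<n. ln lower) \<le> (\<Sum>j<n. ln ((Ts j \<bullet> (G ** Ts j)) / (norm (Ts j))\<^sup>2))"
    by (intro sum_mono) auto
  then have 1: "ln lower \<le> (\<Sum>j<n. ln ((Ts j \<bullet> (G ** Ts j)) / (norm (Ts j))\<^sup>2)) / n"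
    using n by (simp add: le_divide_eq mult.commute)
  \<comment> \<open>Scaling to trace d makes \<open>det_le_one\<close> applicable; undoing it only
    lowers the determinant.\<close>
  have "ln (Re (det (real CARD('d) *\<^sub>R G))) \<le> 0"
    by (rule ln_det_nonpos) (use G assms in \<open>auto simp: pos_def_scaleR trace_scaleR trace_one_ge_def\<close>)
  then have "ln (real CARD('d) ^ CARD('d)) + ln (Re (det G)) \<le> 0"
    using pos_def_det_pos[OF G] by (simp add: pos_def_det_scaleR G ln_mult)
  moreover have "0 \<le> ln (real CARD('d) ^ CARD('d))"
    by (intro ln_ge_zero one_le_power) (simp add: Suc_le_eq)
  ultimately have "ln (Re (det G)) \<le> 0" by linarith
  then have "ln (Re (det G)) / CARD('d) \<le> 0" by (rule divide_nonpos_pos) simp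
  with 1 show ?thesis by (simp add: potential_def)
qed

lemma weighted_cov_tendsto:
  assumes "(G \<longlongrightarrow> L) F" "pos_def L"
  shows "((\<lambda>k. S (G k)) \<longlongrightarrow> S L) F"
  unfolding weighted_cov_def
proof (intro tendsto_intros assms)
  fix j assume "j \<in> {..<n}"
  then show "Ts j \<bullet> (L ** Ts j) \<noteq> 0" using form_pos[OF assms(2)] by force
qed

text \<open>A sample average is an integral over the uniform distribution on \<open>{..<n}\<close>,
  so the measure-theoretic uniqueness result covers sample and population alike.\<close>

lemma fixed_point_unique_sample:
  assumes G1: "pos_def G1" "Re (trace G1) = 1" "G1 ** S G1 = mat 1"
    and G2: "pos_def G2" "Re (trace G2) = 1" "G2 ** S G2 = mat 1"
  shows "G1 = G2"
proof -
  have set: "{..<n} \<noteq> {}" "finite {..<n}" using n by auto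
  have fixp: "x \<bullet> (matrix_inv G *v x) = real CARD('d) * (LINT j|measure_pmf (pmf_of_set {..<n}). (norm (adj (Ts j) *v x))\<^sup>2 / (Ts j \<bullet> (G ** Ts j)))"
    if "pos_def G" "G ** S G = mat 1" for G x
  proof -
    have "matrix_inv G = S G"
      by (rule matrix_inv_unique) (use that in \<open>auto simp: matrix_left_right_inverse_complex\<close>)
    then show ?thesis by (simp add: inner_weighted_cov integral_pmf_of_set[OF set])
  qed
  show ?thesis
  proof (rule fixed_point_unique[of "measure_pmf (pmf_of_set {..<n})" Ts "real CARD('d)" G1 G2])
    show "finite_measure (measure_pmf (pmf_of_set {..<n}))" by unfold_locales simp
    show "\<not> (AE j in measure_pmf (pmf_of_set {..<n}). adj (Ts j) *v v = 0 \<or> adj (Ts j) *v w = 0)"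
      if "v \<noteq> 0" "w \<noteq> 0" for v w
      using ex_nonorthogonal[OF that] by (auto simp: AE_measure_pmf_iff set_pmf_of_set[OF set])
  qed (use G1 G2 in \<open>auto intro!: fixp\<close>)
qed

text \<open>The potential decreases and is bounded below, so its increments tend to 0 and squeeze
  \<open>ln (h k)\<close> to 0. By continuity every limit point is in the equality case of
  \<open>det_product\<close>.\<close>

theorem Gamma_iter_tendsto_fixed_point:
  "\<exists>L\<in>trace_one_ge lower. Gamma_iter n Ts \<longlonglongrightarrow> L \<and> L ** S L = mat 1"
proof -
  define G where "G = Gamma_iter n Ts"
  have d: "real CARD('d) > 0" by simp
  have G0: "G 0 = (1 / real CARD('d)) *\<^sub>R mat 1"
    by (simp add: G_def Gamma_iter_def flip: mscale_of_real)
  have GS: "G (Suc k) = iter_step n Ts (G k)" for k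
    by (simp add: G_def Gamma_iter_def)
  have "potential (mat 1) = 0"
    by (simp add: potential_def power2_norm_eq_inner[symmetric] nonzero)
  then have pot0: "potential (G 0) = 0"
    unfolding G0 by (subst potential_scaleR) (auto simp: pos_def_mat_1)
  have pd: "pos_def (G k) \<and> Re (trace (G k)) = 1" for k
  proof (induction k)
    case 0
    then show ?case by (simp add: G0 pos_def_scaleR pos_def_mat_1 trace_scaleR) (simp add: trace_def mat_def)
  next
    case (Suc k)
    then show ?case by (simp add: GS iter_step_pos_def)
  qed
  define h where "h k = Re (det (G k)) * Re (det (S (G k)))" for k
  have hpos: "h k > 0" for k
    unfolding h_def by (intro mult_pos_pos pos_def_det_pos pos_def_weighted_cov) (simp_all add: pd)
  have descent: "potential (G (Suc k)) \<le> potential (G k) + ln (h k) / CARD('d)" for k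
    unfolding GS h_def using pd by (intro potential_descent) auto
  have hle: "ln (h k) \<le> 0" for k
    unfolding h_def using pd by (intro ln_det_product_nonpos) auto
  have dec: "potential (G (Suc k)) \<le> potential (G k)" for k
    using descent[of k] divide_nonpos_pos[OF hle d, of k] by linarith
  have "potential (G k) \<le> 0" for k
  proof (induction k)
    case (Suc k)
    then show ?case using dec[of k] by linarith
  qed (simp add: pot0)
  then have GK: "G k \<in> trace_one_ge lower" for k
    using pd by (intro coercive) auto
  have "decseq (\<lambda>k. potential (G k))" using dec by (simp add: decseq_Suc_iff)
  then obtain p where p: "(\<lambda>k. potential (G k)) \<longlonglongrightarrow> p"
    using decseq_convergent[of "\<lambda>k. potential (G k)" "ln lower"] potential_bounded_below[OF GK] by blast
  have diff: "(\<lambda>k. potential (G (Suc k)) - potential (G k)) \<longlonglongrightarrow> 0"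
    using tendsto_diff[OF LIMSEQ_Suc[OF p] p] by simp
  have "(\<lambda>k. ln (h k) / CARD('d)) \<longlonglongrightarrow> 0"
  proof (rule tendsto_sandwich[OF _ _ diff tendsto_const])
    show "\<forall>\<^sub>F k in sequentially. potential (G (Suc k)) - potential (G k) \<le> ln (h k) / CARD('d)"
      using descent by (intro always_eventually allI) (simp add: diff_le_eq add.commute)
    show "\<forall>\<^sub>F k in sequentially. ln (h k) / CARD('d) \<le> 0"
      using hle d by (intro always_eventually allI divide_nonpos_pos)
  qed
  from tendsto_exp[OF tendsto_mult_left[OF this, of "real CARD('d)"]]
  have h: "h \<longlonglongrightarrow> 1" using hpos by simp
  have limit: "L \<in> trace_one_ge lower \<and> L ** S L = mat 1"
    if r: "strict_mono r" and L: "(G \<circ> r) \<longlonglongrightarrow> L" for r L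
  proof -
    have LK: "L \<in> trace_one_ge lower"
      by (rule closed_sequentially[OF compact_imp_closed[OF compact_trace_one_ge[OF lower_pos]] _ L])
         (simp add: GK)
    then have pL: "pos_def L" by (rule trace_one_ge_pos_def[OF lower_pos])
    have "(\<lambda>k. h (r k)) \<longlonglongrightarrow> Re (det L) * Re (det (S L))"
      unfolding h_def
      by (intro tendsto_intros tendsto_det weighted_cov_tendsto pL) (use L in \<open>simp_all add: comp_def\<close>)
    moreover have "(\<lambda>k. h (r k)) \<longlonglongrightarrow> 1"
      using LIMSEQ_subseq_LIMSEQ[OF h r] by (simp add: comp_def)
    ultimately have "Re (det L) * Re (det (S L)) = 1" by (rule LIMSEQ_unique)
    with LK show ?thesis by (simp add: det_product_eq_one pL)
  qed
  obtain L r where "L \<in> trace_one_ge lower" and L: "strict_mono r" "(G \<circ> r) \<longlonglongrightarrow> L"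
    by (rule seq_compactE[OF compact_imp_seq_compact[OF compact_trace_one_ge[OF lower_pos]], of G]) (simp add: GK)
  note LK = limit[OF L]
  have "G \<longlonglongrightarrow> L"
  proof (rule compact_unique_limit_point[OF compact_trace_one_ge[OF lower_pos] GK])
    fix r l assume "strict_mono r" "(G \<circ> r) \<longlonglongrightarrow> l"
    note l = limit[OF this]
    show "l = L"
    proof (rule fixed_point_unique_sample)
      show "pos_def l" "pos_def L" using l LK by (simp_all add: trace_one_ge_pos_def[OF lower_pos])
    qed (use l LK in \<open>simp_all add: trace_one_ge_def\<close>)
  qed
  with LK have "L \<in> trace_one_ge lower" "Gamma_iter n Ts \<longlonglongrightarrow> L \<and> L ** S L = mat 1"
    unfolding G_def by simp_all
  then show ?thesis by (rule bexI[rotated])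
qed

end

section \<open>A strong law for bounded random variables\<close>

text \<open>By Hoeffding's inequality the probability of a deviation of size \<open>e\<close> decays
  geometrically in \<open>n\<close>, hence is summable; Borel-Cantelli then leaves finitely many
  deviations.\<close>

lemma (in prob_space) slln_bounded_real:
  fixes X :: "nat \<Rightarrow> 'a \<Rightarrow> real"
  assumes indep: "indep_vars (\<lambda>_. borel) X UNIV"
    and distr: "\<And>j. distr M borel (X j) = distr M borel Y"
    and Y: "random_variable borel Y" and bound: "AE x in M. Y x \<in> {a..b}"
  shows "AE x in M. (\<lambda>n. (\<Sum>j<n. X j x) / n) \<longlonglongrightarrow> expectation Y"
proof -
  \<comment> \<open>Enlarges the interval to positive length even if \<open>a = b\<close>, since the
    Hoeffding exponent divides by the length.\<close>
  define B where "B = b + \<bar>a\<bar> + \<bar>b\<bar> + 1"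
  have bound': "AE x in M. Y x \<in> {a..B}"
    using bound by (rule eventually_mono) (auto simp: B_def)
  have aB: "a < B" by (simp add: B_def)
  have [measurable]: "random_variable borel (X j)" for j
    using indep unfolding indep_vars_def by blast
  have ev: "AE x in M. \<forall>\<^sub>F n in sequentially. \<bar>(\<Sum>j<n. X j x) / n - expectation Y\<bar> < e" if e: "e > 0" for e
  proof -
    define A where "A n = {x \<in> space M. \<bar>(\<Sum>j<n. X j x) / n - expectation Y\<bar> \<ge> e}" for n :: nat
    define q where "q = exp (- 2 * e\<^sup>2 / (B - a)\<^sup>2)"
    have q: "0 \<le> q" "q < 1" using e aB by (auto simp: q_def)
    have le: "measure M (A n) \<le> 2 * q ^ n" if "n > 0" for n
    proof -
      interpret H: Hoeffding_ineq_iid M "{..<n}" X Y a B "expectation Y"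
      proof unfold_locales
        show "indep_vars (\<lambda>_. borel) X {..<n}" by (rule indep_vars_subset[OF indep]) simp
      qed (use distr Y bound' in auto)
      have "{..<n} \<noteq> {}" using that by auto
      from H.Hoeffding_ineq_abs_ge'[OF less_imp_le[OF e] aB this]
      have "measure M (A n) \<le> 2 * exp (- 2 * n * e\<^sup>2 / (B - a)\<^sup>2)"
        by (simp add: A_def)
      also have "exp (- 2 * n * e\<^sup>2 / (B - a)\<^sup>2) = q ^ n"
        unfolding q_def exp_of_nat_mult[symmetric] by (simp add: mult_ac)
      finally show ?thesis .
    qed
    have "\<forall>\<^sub>F n in sequentially. norm (measure M (A n)) \<le> 2 * q ^ n"
      by (rule eventually_mono[OF eventually_gt_at_top[of 0]]) (use le in simp)
    moreover have "summable (\<lambda>n. 2 * q ^ n)"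
      using q by (intro summable_mult summable_geometric) simp
    ultimately have sum: "summable (\<lambda>n. measure M (A n))"
      by (rule summable_comparison_test_ev)
    have "AE x in M. \<forall>\<^sub>F n in sequentially. x \<in> space M - A n"
    proof (rule borel_cantelli_AE1[OF _ _ sum])
      show "A n \<in> sets M" for n unfolding A_def by measurable
      show "emeasure M (A n) < \<infinity>" for n by (simp add: emeasure_eq_measure)
    qed
    then show ?thesis
      by (rule eventually_mono) (erule eventually_mono, auto simp: A_def)
  qed
  \<comment> \<open>Countably many tolerances, so that one null set serves for all.\<close>
  have "AE x in M. \<forall>k :: nat. \<forall>\<^sub>F n in sequentially. \<bar>(\<Sum>j<n. X j x) / n - expectation Y\<bar> < 1 / Suc k"
    unfolding AE_all_countable by (intro allI ev) simp
  then show ?thesis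
  proof (rule eventually_mono)
    fix x assume x: "\<forall>k :: nat. \<forall>\<^sub>F n in sequentially. \<bar>(\<Sum>j<n. X j x) / n - expectation Y\<bar> < 1 / Suc k"
    show "(\<lambda>n. (\<Sum>j<n. X j x) / n) \<longlonglongrightarrow> expectation Y"
    proof (rule tendstoI)
      fix e :: real assume "e > 0"
      then obtain k where k: "1 / real (Suc k) < e" using nat_approx_posE by blast
      show "\<forall>\<^sub>F n in sequentially. dist ((\<Sum>j<n. X j x) / n) (expectation Y) < e"
        using x[rule_format, of k] by (rule eventually_mono) (use k in \<open>simp only: dist_real_def\<close>)
    qed
  qed
qed

section \<open>Strong laws for vector-valued and for parametrised summands\<close>

locale iid_sample = prob_space M for M :: "'a measure" +
  fixes N :: "'b :: euclidean_space measure" and T :: "'a \<Rightarrow> 'b" and Ts :: "nat \<Rightarrow> 'a \<Rightarrow> 'b"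
  assumes sets_N: "sets N = sets borel"
    and T_N: "T \<in> measurable M N"
    and indep: "indep_vars (\<lambda>_. N) Ts UNIV"
    and same_distr: "\<And>j. distr M N (Ts j) = distr M N T"
begin

lemma T_borel [measurable]: "T \<in> borel_measurable M"
  using T_N by (simp add: measurable_cong_sets[OF refl sets_N])

lemma Ts_N: "Ts j \<in> measurable M N"
  using indep unfolding indep_vars_def by blast

lemma measurable_N: "measurable N A = measurable borel A"
  by (rule measurable_cong_sets[OF sets_N refl])

text \<open>Almost sure properties depend on the law alone, so they pass from \<open>T\<close> to
  each \<open>Ts j\<close>.\<close>

lemma AE_sample:
  assumes "AE \<omega> in M. P (T \<omega>)" and P [measurable]: "Measurable.pred borel P"
  shows "AE \<omega> in M. P (Ts j \<omega>)"
proof -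
  have PN: "{x \<in> space N. P x} \<in> sets N"
    using P sets_N sets_eq_imp_space_eq[OF sets_N] by (simp add: pred_def)
  have "AE x in distr M N T. P x" using assms(1) by (subst AE_distr_iff[OF T_N PN])
  then have "AE x in distr M N (Ts j). P x" by (simp only: same_distr)
  then show ?thesis by (subst (asm) AE_distr_iff[OF Ts_N PN])
qed

lemma slln_bounded:
  fixes g :: "'b \<Rightarrow> 'c :: euclidean_space"
  assumes g [measurable]: "g \<in> borel_measurable borel" and bound: "\<And>t. norm (g t) \<le> B"
  shows "AE \<omega> in M. (\<lambda>n. (1 / real n) *\<^sub>R (\<Sum>j<n. g (Ts j \<omega>))) \<longlonglongrightarrow> expectation (\<lambda>\<omega>. g (T \<omega>))"
proof -
  have int: "integrable M (\<lambda>\<omega>. g (T \<omega>))"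
    using bound by (intro integrable_const_bound[where B = B]) auto
  have "AE \<omega> in M. (\<lambda>n. (\<Sum>j<n. g (Ts j \<omega>) \<bullet> b) / n) \<longlonglongrightarrow> expectation (\<lambda>\<omega>. g (T \<omega>) \<bullet> b)"
    if b: "b \<in> Basis" for b
  proof (rule slln_bounded_real[where a = "- B" and b = B])
    have gb: "(\<lambda>t. g t \<bullet> b) \<in> measurable N borel" unfolding measurable_N by measurable
    show "indep_vars (\<lambda>_. borel) (\<lambda>j \<omega>. g (Ts j \<omega>) \<bullet> b) UNIV"
      by (rule indep_vars_compose2[OF indep]) (use gb in simp)
    show "distr M borel (\<lambda>\<omega>. g (Ts j \<omega>) \<bullet> b) = distr M borel (\<lambda>\<omega>. g (T \<omega>) \<bullet> b)" for j
      using distr_distr[OF gb Ts_N[of j]] distr_distr[OF gb T_N] same_distr[of j] by (simp add: comp_def)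
    show "AE \<omega> in M. g (T \<omega>) \<bullet> b \<in> {- B..B}"
      using order_trans[OF Basis_le_norm[OF b] bound] by (auto simp: abs_le_iff intro!: AE_I2) (smt (verit))+
  qed simp
  then have "AE \<omega> in M. \<forall>b\<in>Basis. (\<lambda>n. (\<Sum>j<n. g (Ts j \<omega>) \<bullet> b) / n) \<longlonglongrightarrow> expectation (\<lambda>\<omega>. g (T \<omega>) \<bullet> b)"
    by (intro AE_finite_allI) auto
  then show ?thesis
    by (rule eventually_mono)
       (subst tendsto_componentwise_iff, simp add: inner_sum_left int)
qed

text \<open>By the Lipschitz condition it suffices to have the law at countably many parameters.\<close>

lemma slln_lipschitz:
  fixes g :: "'p :: euclidean_space \<Rightarrow> 'b \<Rightarrow> 'c :: euclidean_space"
  assumes g [measurable]: "\<And>x. x \<in> S \<Longrightarrow> g x \<in> borel_measurable borel"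
    and bound: "\<And>x t. x \<in> S \<Longrightarrow> norm (g x t) \<le> B"
    and lip: "\<And>x y t. x \<in> S \<Longrightarrow> y \<in> S \<Longrightarrow> norm (g x t - g y t) \<le> C * norm (x - y)"
  shows "AE \<omega> in M. \<forall>(s :: nat \<Rightarrow> nat) y L. filterlim s at_top sequentially \<longrightarrow> (\<forall>k. y k \<in> S) \<longrightarrow> L \<in> S \<longrightarrow> y \<longlonglongrightarrow> L \<longrightarrow>
    (\<lambda>k. (1 / real (s k)) *\<^sub>R (\<Sum>j<s k. g (y k) (Ts j \<omega>))) \<longlonglongrightarrow> expectation (\<lambda>\<omega>. g L (T \<omega>))"
proof -
  obtain Q where Q: "countable Q" "Q \<subseteq> S" "S \<subseteq> closure Q" using separable by metis
  define avg where "avg n x \<omega> = (1 / real n) *\<^sub>R (\<Sum>j<n. g x (Ts j \<omega>))" for n x \<omega>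
  define E where "E x = expectation (\<lambda>\<omega>. g x (T \<omega>))" for x
  have "AE \<omega> in M. (\<lambda>n. avg n x \<omega>) \<longlonglongrightarrow> E x" if "x \<in> Q" for x
    unfolding avg_def E_def
    using that Q(2) by (intro slln_bounded[where B = B] g bound) auto
  then have "AE \<omega> in M. \<forall>x\<in>Q. (\<lambda>n. avg n x \<omega>) \<longlonglongrightarrow> E x"
    using Q(1) by (subst AE_ball_countable) auto
  then show ?thesis
  proof (rule eventually_mono, intro allI impI)
    fix \<omega> y L and s :: "nat \<Rightarrow> nat"
    assume \<omega>: "\<forall>x\<in>Q. (\<lambda>n. avg n x \<omega>) \<longlonglongrightarrow> E x" and s: "filterlim s at_top sequentially"
      and y: "\<forall>k :: nat. y k \<in> S" "L \<in> S" "y \<longlonglongrightarrow> L"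
    \<comment> \<open>A strictly positive Lipschitz constant, so that \<open>\<delta>\<close> can
      divide by it.\<close>
    define C' where "C' = \<bar>C\<bar> + 1"
    have C': "C' > 0" by (simp add: C'_def)
    have lip': "norm (g x t - g z t) \<le> C' * norm (x - z)" if "x \<in> S" "z \<in> S" for x z t
    proof -
      have "C * norm (x - z) \<le> C' * norm (x - z)" by (rule mult_right_mono) (auto simp: C'_def)
      then show ?thesis using lip[OF that, of t] by linarith
    qed
    have avg: "dist (avg n x \<omega>) (avg n z \<omega>) \<le> C' * norm (x - z)" if "x \<in> S" "z \<in> S" for n x z
    proof (cases "n = 0")
      case False
      have "norm (\<Sum>j<n. g x (Ts j \<omega>) - g z (Ts j \<omega>)) \<le> (\<Sum>j<n. C' * norm (x - z))"
        by (rule sum_norm_le) (rule lip'[OF that])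
      then have "norm (\<Sum>j<n. g x (Ts j \<omega>) - g z (Ts j \<omega>)) / n \<le> C' * norm (x - z)"
        using False by (simp add: divide_le_eq mult.commute)
      then show ?thesis
        by (simp add: avg_def dist_norm sum_subtractf flip: scaleR_diff_right)
    qed (use C' in \<open>simp add: avg_def\<close>)
    have int: "integrable M (\<lambda>\<omega>. g x (T \<omega>))" if "x \<in> S" for x
      using bound[OF that] measurable_compose[OF T_borel g[OF that]]
      by (intro integrable_const_bound[where B = B]) auto
    have E: "dist (E x) (E z) \<le> C' * norm (x - z)" if "x \<in> S" "z \<in> S" for x z
    proof -
      have "norm (expectation (\<lambda>\<omega>. g x (T \<omega>) - g z (T \<omega>))) \<le> expectation (\<lambda>\<omega>. norm (g x (T \<omega>) - g z (T \<omega>)))"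
        by (rule integral_norm_bound)
      also have "\<dots> \<le> expectation (\<lambda>\<omega>. C' * norm (x - z))"
        using int[OF that(1)] int[OF that(2)] by (intro integral_mono lip'[OF that]) auto
      also have "\<dots> = C' * norm (x - z)" by (simp add: prob_space)
      finally show ?thesis using int that by (simp add: E_def dist_norm)
    qed
    have "(\<lambda>k. avg (s k) (y k) \<omega>) \<longlonglongrightarrow> E L"
    proof (rule tendstoI)
      fix e :: real assume "e > 0"
      \<comment> \<open>Four errors below \<open>e / 4\<close>: from \<open>y k\<close> to
        \<open>L\<close>, from \<open>L\<close> to the dense point \<open>q\<close>, the law at
        \<open>q\<close>, and from \<open>q\<close> back to \<open>L\<close> in the
        expectation.\<close>
      define \<delta> where "\<delta> = e / (4 * C')"
      have \<delta>: "\<delta> > 0" "C' * \<delta> = e / 4" using \<open>e > 0\<close> C' by (simp_all add: \<delta>_def)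
      obtain q where q: "q \<in> Q" "dist q L < \<delta>"
        using y(2) Q(3) \<delta>(1) by (meson closure_approachable subsetD)
      have qS: "q \<in> S" using q Q by auto
      have "\<forall>\<^sub>F n in sequentially. dist (avg n q \<omega>) (E q) < e / 4"
        using \<omega> q(1) \<open>e > 0\<close> by (intro tendstoD) auto
      then have "\<forall>\<^sub>F k in sequentially. dist (avg (s k) q \<omega>) (E q) < e / 4"
        using s by (rule eventually_compose_filterlim)
      moreover have "\<forall>\<^sub>F k in sequentially. dist (y k) L < \<delta>"
        using y(3) \<delta>(1) by (rule tendstoD)
      ultimately show "\<forall>\<^sub>F k in sequentially. dist (avg (s k) (y k) \<omega>) (E L) < e"
      proof eventually_elim
        case (elim k)
        have Cd: "C' * norm (x - z) < e / 4" if "dist x z < \<delta>" for x z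
          using mult_strict_left_mono[OF that C'] by (simp add: \<delta>(2) dist_norm)
        have "dist (avg (s k) (y k) \<omega>) (avg (s k) L \<omega>) < e / 4"
          using avg[of "y k" L "s k"] y Cd[OF elim(2)] by auto
        moreover have "dist (avg (s k) L \<omega>) (avg (s k) q \<omega>) < e / 4"
          using avg[of L q "s k"] y(2) qS Cd[of L q] q(2) by (auto simp: dist_commute)
        moreover have "dist (E q) (E L) < e / 4"
          using E[of q L] y(2) qS Cd[OF q(2)] by auto
        ultimately show ?case
          using elim(1) dist_triangle[of "avg (s k) (y k) \<omega>" "E L" "avg (s k) L \<omega>"]
            dist_triangle[of "avg (s k) L \<omega>" "E L" "avg (s k) q \<omega>"] dist_triangle[of "avg (s k) q \<omega>" "E L" "E q"]
          by linarith
      qed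
    qed
    then show "(\<lambda>k. (1 / real (s k)) *\<^sub>R (\<Sum>j<s k. g (y k) (Ts j \<omega>))) \<longlonglongrightarrow> expectation (\<lambda>\<omega>. g L (T \<omega>))"
      by (simp add: avg_def E_def)
  qed
qed

end

section \<open>Continuously distributed samples\<close>

lemma sets_Kmat_lebesgue: "sets (Kmat_lebesgue is_real) = sets borel"
  by (simp add: Kmat_lebesgue_def)

lemma AE_lborel_inner_nonzero:
  fixes a :: "'a :: euclidean_space"
  assumes "a \<noteq> 0"
  shows "AE x in lborel. a \<bullet> x \<noteq> 0"
proof -
  have "{x. a \<bullet> x = 0} \<in> null_sets lborel"
    using negligible_hyperplane[of a 0] assms
    by (simp add: negligible_iff_null_sets null_sets_completion_iff)
  from AE_not_in[OF this] show ?thesis by simp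
qed

lemma measurable_adj_vector [measurable]: "Measurable.pred borel (\<lambda>t :: complex^'r^'d. adj t *v v \<noteq> 0)"
proof -
  have [measurable]: "(\<lambda>t :: complex^'r^'d. adj t *v v) \<in> borel_measurable borel"
    by (intro borel_measurable_continuous_onI continuous_intros)
  show ?thesis by measurable
qed

text \<open>Orthogonality to \<open>v\<close> implies one nontrivial real linear equation for the
  entries of \<open>t\<close>, which confines them to a null hyperplane. For real \<open>t\<close>
  the vector \<open>v\<close> may still be complex, so a nonvanishing real or imaginary part is
  selected.\<close>

lemma AE_Kmat_lebesgue_nonorthogonal:
  fixes v :: "complex^'d"
  assumes "v \<noteq> 0"
  shows "AE t in (Kmat_lebesgue is_real :: (complex^'r^'d) measure). adj t *v v \<noteq> 0"
proof (cases is_real)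
  case False
  \<comment> \<open>With \<open>v\<close> in every column, \<open>a \<bullet> t\<close> is the sum
    of the real parts of the coordinates of \<open>adj t *v v\<close>.\<close>
  define a :: "complex^'r^'d" where "a = (\<chi> i j. v $ i)"
  have "a \<noteq> 0" using assms by (auto simp: a_def vec_eq_iff)
  have "a \<bullet> t = (\<Sum>j\<in>UNIV. Re ((adj t *v v) $ j))" for t :: "complex^'r^'d"
    unfolding a_def inner_vec_def matrix_vector_mult_def
    by (simp add: inner_complex_def) (subst sum.swap, simp add: mult.commute)
  then have "adj t *v v \<noteq> 0" if "a \<bullet> t \<noteq> 0" for t :: "complex^'r^'d"
    using that by auto
  with AE_lborel_inner_nonzero[OF \<open>a \<noteq> 0\<close>] have ae: "AE t in lborel. adj (t :: complex^'r^'d) *v v \<noteq> 0"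
    by (rule eventually_mono)
  have "(Kmat_lebesgue is_real :: (complex^'r^'d) measure) = lborel"
    using False by (simp add: Kmat_lebesgue_def)
  then show ?thesis by (rule ssubst) (rule ae)
next
  case True
  define e :: "real^'r^'d \<Rightarrow> complex^'r^'d" where "e A = (\<chi> i j. complex_of_real (A $ i $ j))" for A
  have e_eq: "(\<lambda>A. \<chi> i j. complex_of_real (A $ i $ j)) = e" by (auto simp: e_def)
  have [measurable]: "e \<in> borel_measurable borel"
    unfolding e_def by (intro borel_measurable_continuous_onI continuous_intros)
  obtain p :: "complex \<Rightarrow> real" where p: "p = Re \<or> p = Im" "\<exists>i. p (v $ i) \<noteq> 0"
    using assms by (auto simp: vec_eq_iff complex_eq_iff)
  define a :: "real^'r^'d" where "a = (\<chi> i j. p (v $ i))"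
  have "a \<noteq> 0" using p by (auto simp: a_def vec_eq_iff)
  have "a \<bullet> A = (\<Sum>j\<in>UNIV. p ((adj (e A) *v v) $ j))" for A
    using p(1) unfolding a_def inner_vec_def matrix_vector_mult_def e_def
    by (auto simp: mult.commute) (subst sum.swap, simp add: mult.commute)+
  moreover have "p 0 = 0" using p(1) by auto
  ultimately have "adj (e A) *v v \<noteq> 0" if "a \<bullet> A \<noteq> 0" for A
    using that by auto
  then have "AE A in lborel. adj (e A) *v v \<noteq> 0"
    using AE_lborel_inner_nonzero[OF \<open>a \<noteq> 0\<close>] by (auto elim: eventually_mono)
  then show ?thesis
    unfolding Kmat_lebesgue_def e_eq using True by (simp add: AE_distr_iff)
qed

definition cov_term :: "complex^'d^'d \<Rightarrow> complex^'r^'d \<Rightarrow> complex^'d^'d" where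
  "cov_term G t = (1 / (t \<bullet> (G ** t))) *\<^sub>R (t ** adj t)"

lemma weighted_cov_eq: "weighted_cov n Ts G = real CARD('d) *\<^sub>R ((1 / real n) *\<^sub>R (\<Sum>j<n. cov_term G (Ts j)))"
  for Ts :: "nat \<Rightarrow> complex^'r^'d"
  by (simp add: weighted_cov_def cov_term_def)

lemma measurable_cov_term [measurable]: "cov_term G \<in> borel_measurable borel"
  unfolding cov_term_def
  by (intro borel_measurable_scaleR borel_measurable_divide borel_measurable_const borel_measurable_continuous_onI continuous_intros)

text \<open>Uniformity in \<open>t\<close> comes from homogeneity of degree 0. In the Lipschitz
  bound the difference of the two reciprocals is of order
  \<open>norm (G - H) / (norm t)\<^sup>2\<close>, and \<open>t ** adj t\<close> restores the missing
  \<open>(norm t)\<^sup>2\<close>.\<close>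

lemma cov_term_bounds:
  assumes c: "c > 0"
  shows "\<exists>B. \<forall>G\<in>trace_one_ge c. \<forall>t :: complex^'r^'d. norm (cov_term G t) \<le> B"
    and "\<exists>C. \<forall>G\<in>trace_one_ge c. \<forall>H\<in>trace_one_ge c. \<forall>t :: complex^'r^'d.
      norm (cov_term G t - cov_term H t) \<le> C * norm (G - H)"
proof -
  obtain K1 where K1: "K1 > 0" "\<And>t (s :: complex^'d^'r). norm ((t :: complex^'r^'d) ** s) \<le> norm t * norm s * K1"
    using bounded_bilinear.pos_bounded[OF bounded_bilinear_matrix_mult] by blast
  obtain K2 where K2: "K2 > 0" "\<And>D (t :: complex^'r^'d). norm ((D :: complex^'d^'d) ** t) \<le> norm D * norm t * K2"
    using bounded_bilinear.pos_bounded[OF bounded_bilinear_matrix_mult] by blast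
  have tt: "norm (t ** adj t) \<le> K1 * (norm t)\<^sup>2" for t :: "complex^'r^'d"
    using K1(2)[of t "adj t"] by (simp add: norm_adj power2_eq_square mult_ac)
  have lower: "c * (norm t)\<^sup>2 \<le> t \<bullet> (G ** t)" if "G \<in> trace_one_ge c" for G and t :: "complex^'r^'d"
    using that by (intro inner_matrix_lower_bound) (auto simp: trace_one_ge_def)
  have "norm (cov_term G t) \<le> K1 / c" if G: "G \<in> trace_one_ge c" for G and t :: "complex^'r^'d"
  proof (cases "t = 0")
    case False
    then have t: "c * (norm t)\<^sup>2 > 0" using c by simp
    have "norm (cov_term G t) = norm (t ** adj t) / (t \<bullet> (G ** t))"
      using t lower[OF G, of t] by (simp add: cov_term_def)
    also have "\<dots> \<le> (K1 * (norm t)\<^sup>2) / (c * (norm t)\<^sup>2)"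
      using t lower[OF G, of t] tt K1(1) by (intro frac_le) auto
    also have "\<dots> = K1 / c" using False by simp
    finally show ?thesis .
  qed (use K1 c in \<open>simp add: cov_term_def\<close>)
  then show "\<exists>B. \<forall>G\<in>trace_one_ge c. \<forall>t :: complex^'r^'d. norm (cov_term G t) \<le> B" by blast
  have "norm (cov_term G t - cov_term H t) \<le> (K1 * K2 / c\<^sup>2) * norm (G - H)"
    if G: "G \<in> trace_one_ge c" and H: "H \<in> trace_one_ge c" for G H and t :: "complex^'r^'d"
  proof (cases "t = 0")
    case False
    define a b where "a = t \<bullet> (G ** t)" and "b = t \<bullet> (H ** t)"
    define u where "u = (norm t)\<^sup>2"
    have u: "u > 0" using False by (simp add: u_def)
    have cu: "c * u > 0" using u c by simp
    have ab: "c * u \<le> a" "c * u \<le> b" using lower G H by (simp_all add: a_def b_def u_def)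
    have "b - a = t \<bullet> ((H - G) ** t)"
      by (simp add: a_def b_def matrix_mult_diff_left inner_diff_right)
    then have "\<bar>b - a\<bar> \<le> norm t * norm ((H - G) ** t)"
      using Cauchy_Schwarz_ineq2 by simp
    also have "\<dots> \<le> norm t * (norm (H - G) * norm t * K2)"
      by (intro mult_left_mono K2(2)) simp
    finally have ba: "\<bar>b - a\<bar> \<le> K2 * norm (G - H) * u"
      by (simp add: u_def power2_eq_square norm_minus_commute mult_ac)
    have "cov_term G t - cov_term H t = (1 / a - 1 / b) *\<^sub>R (t ** adj t)"
      by (simp add: cov_term_def a_def b_def scaleR_diff_left)
    also have "1 / a - 1 / b = (b - a) / (a * b)"
      using ab cu by (simp add: diff_frac_eq)
    finally have "norm (cov_term G t - cov_term H t) = \<bar>b - a\<bar> * norm (t ** adj t) / (a * b)"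
      using ab cu by (simp add: abs_mult)
    also have "\<dots> \<le> (K2 * norm (G - H) * u) * (K1 * u) / ((c * u) * (c * u))"
      using ab cu ba tt[of t] K1(1) K2(1) u
      by (intro frac_le mult_mono) (auto simp: u_def)
    also have "\<dots> = (K1 * K2 / c\<^sup>2) * norm (G - H)"
      using u c by (simp add: power2_eq_square field_simps)
    finally show ?thesis .
  qed (use K1(1) K2(1) in \<open>simp add: cov_term_def\<close>)
  then show "\<exists>C. \<forall>G\<in>trace_one_ge c. \<forall>H\<in>trace_one_ge c. \<forall>t :: complex^'r^'d.
      norm (cov_term G t - cov_term H t) \<le> C * norm (G - H)" by blast
qed

text \<open>Gives one good outcome, from which non-random facts are read off: positivity of the slab
  width and existence of the limit.\<close>

lemma (in prob_space) AE_imp_ex: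
  assumes "AE \<omega> in M. P \<omega>"
  shows "\<exists>\<omega>. P \<omega>"
proof (rule ccontr)
  assume "\<nexists>\<omega>. P \<omega>"
  then have "AE \<omega> in M. False" using assms by simp
  then show False by (simp add: AE_False)
qed

section \<open>Almost sure slab condition, population equation and consistency\<close>

locale nondegenerate_sample = iid_sample M N T Ts
  for M :: "'a measure" and N :: "(complex^'r^'d) measure" and T Ts +
  assumes nondegenerate: "\<And>v :: complex^'d. v \<noteq> 0 \<Longrightarrow> AE \<omega> in M. adj (T \<omega>) *v v \<noteq> 0"
begin

text \<open>Almost surely \<open>adj (T \<omega>) *v v\<close> is nonzero, so
  \<open>T \<omega>\<close> leaves the slabs once they are thin enough; dominated convergence passes
  this to probabilities.\<close>

lemma slab_probability_small:
  assumes v: "v \<noteq> 0" and e: "e > 0"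
  shows "\<exists>\<delta>>0. expectation (\<lambda>\<omega>. of_bool (norm (adj (T \<omega>) *v v) < \<delta> * norm (T \<omega>))) < (e :: real)"
proof -
  define g where "g k \<omega> = (of_bool (norm (adj (T \<omega>) *v v) < (1 / real (Suc k)) * norm (T \<omega>)) :: real)" for k \<omega>
  have [measurable]: "(\<lambda>\<omega>. adj (T \<omega>) *v v) \<in> borel_measurable M"
    by (rule measurable_compose[OF T_borel]) (intro borel_measurable_continuous_onI continuous_intros)
  have "(\<lambda>k. expectation (g k)) \<longlonglongrightarrow> expectation (\<lambda>\<omega>. 0)"
  proof (rule integral_dominated_convergence[where w = "\<lambda>_. 1"])
    show "g k \<in> borel_measurable M" for k unfolding g_def by measurable
    show "AE \<omega> in M. (\<lambda>k. g k \<omega>) \<longlonglongrightarrow> 0"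
      using nondegenerate[OF v]
    proof (rule eventually_mono)
      fix \<omega> assume "adj (T \<omega>) *v v \<noteq> 0"
      then have "0 < norm (adj (T \<omega>) *v v)" by simp
      moreover have "(\<lambda>k. (1 / real (Suc k)) * norm (T \<omega>)) \<longlonglongrightarrow> 0 * norm (T \<omega>)"
        by (intro tendsto_intros LIMSEQ_inverse_real_of_nat[unfolded inverse_eq_divide])
      ultimately have "\<forall>\<^sub>F k in sequentially. (1 / real (Suc k)) * norm (T \<omega>) < norm (adj (T \<omega>) *v v)"
        by (intro order_tendstoD(2)) auto
      then have "\<forall>\<^sub>F k in sequentially. g k \<omega> = 0"
        by (rule eventually_mono) (simp add: g_def)
      then show "(\<lambda>k. g k \<omega>) \<longlonglongrightarrow> 0" by (rule tendsto_eventually)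
    qed
  qed (auto simp: g_def)
  then have "\<forall>\<^sub>F k in sequentially. expectation (g k) < e"
    using e by (intro order_tendstoD(2)) auto
  then obtain k where "expectation (g k) < e" by (auto simp: eventually_sequentially)
  then show ?thesis
    unfolding g_def by (intro exI[of _ "1 / real (Suc k)"]) simp
qed

lemma AE_nonzero: "AE \<omega> in M. \<forall>j. Ts j \<omega> \<noteq> 0"
proof -
  have "(axis undefined 1 :: complex^'d) \<noteq> 0" by (simp add: axis_eq_0_iff)
  from nondegenerate[OF this] have "AE \<omega> in M. T \<omega> \<noteq> 0"
    by (rule eventually_mono) auto
  then show ?thesis
    unfolding AE_all_countable by (intro allI AE_sample) auto
qed

text \<open>Uncountably many directions are reduced to finitely many: by compactness every unit
  vector \<open>v\<close> is close to some \<open>u\<close> in a finite set, and a thin slab for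
  \<open>v\<close> lies in a wider slab for \<open>u\<close>. The strong law is applied to the
  indicators of these wider slabs.\<close>

lemma eventually_spread_sample:
  "\<exists>\<epsilon>. AE \<omega> in M. \<forall>\<^sub>F n in sequentially. spread_sample n (\<lambda>j. Ts j \<omega>) \<epsilon>"
proof -
  define p where "p = 1 / (2 * real CARD('d))"
  have p: "p > 0" by (simp add: p_def)
  define slab where "slab u \<delta> t \<longleftrightarrow> norm (adj t *v u) < \<delta> * norm t"
    for u :: "complex^'d" and \<delta> and t :: "complex^'r^'d"
  \<comment> \<open>Of the width \<open>2 * \<delta>\<close>, one half is for the slab of a nearby
    direction and one for the distance between the directions.\<close>
  have "\<exists>\<delta>>0. expectation (\<lambda>\<omega>. of_bool (slab u (2 * \<delta>) (T \<omega>))) < p" if "norm u = 1" for u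
  proof -
    have "u \<noteq> 0" using that by auto
    from slab_probability_small[OF this p] obtain \<delta> where "\<delta> > 0"
      "expectation (\<lambda>\<omega>. of_bool (slab u \<delta> (T \<omega>))) < p" unfolding slab_def by blast
    then show ?thesis by (intro exI[of _ "\<delta> / 2"]) simp
  qed
  then obtain d where d: "\<And>u. norm u = 1 \<Longrightarrow> d u > 0"
    "\<And>u. norm u = 1 \<Longrightarrow> expectation (\<lambda>\<omega>. of_bool (slab u (2 * d u) (T \<omega>))) < p" by metis
  obtain F where F: "F \<subseteq> sphere 0 1" "finite F" "sphere 0 1 \<subseteq> (\<Union>u\<in>F. ball u (d u))"
  proof (rule compactE_image[of "sphere 0 1" "sphere 0 1" "\<lambda>u :: complex^'d. ball u (d u)"])
    show "sphere 0 1 \<subseteq> (\<Union>u\<in>sphere 0 1. ball u (d u))" using d(1) by force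
  qed (use that in auto)
  \<comment> \<open>The inserted 1 gives \<open>\<epsilon> \<le> 1\<close>, as
    \<open>spread_sample\<close> requires.\<close>
  define \<epsilon> where "\<epsilon> = Min (insert 1 (d ` F))"
  have eps: "0 < \<epsilon>" "\<epsilon> \<le> 1" using F(1,2) d(1) by (auto simp: \<epsilon>_def)
  have eps_le: "\<epsilon> \<le> d u" if "u \<in> F" for u
    using F(2) that by (simp add: \<epsilon>_def)
  have "AE \<omega> in M. \<forall>u\<in>F. (\<lambda>n. (1 / real n) *\<^sub>R (\<Sum>j<n. of_bool (slab u (2 * d u) (Ts j \<omega>))))
      \<longlonglongrightarrow> expectation (\<lambda>\<omega>. of_bool (slab u (2 * d u) (T \<omega>)) :: real)"
  proof (rule AE_finite_allI[OF F(2)], rule slln_bounded[where B = 1])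
    fix u
    have [measurable]: "(\<lambda>t :: complex^'r^'d. adj t *v u) \<in> borel_measurable borel"
      by (intro borel_measurable_continuous_onI continuous_intros)
    show "(\<lambda>t. of_bool (slab u (2 * d u) t) :: real) \<in> borel_measurable borel"
      unfolding slab_def by measurable
  qed simp
  with AE_nonzero have "AE \<omega> in M. \<forall>\<^sub>F n in sequentially. spread_sample n (\<lambda>j. Ts j \<omega>) \<epsilon>"
  proof eventually_elim
    fix \<omega> assume nonzero: "\<forall>j. Ts j \<omega> \<noteq> 0"
      and lim: "\<forall>u\<in>F. (\<lambda>n. (1 / real n) *\<^sub>R (\<Sum>j<n. of_bool (slab u (2 * d u) (Ts j \<omega>))))
        \<longlonglongrightarrow> expectation (\<lambda>\<omega>. of_bool (slab u (2 * d u) (T \<omega>)) :: real)"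
    have "\<forall>\<^sub>F n in sequentially. (1 / real n) *\<^sub>R (\<Sum>j<n. of_bool (slab u (2 * d u) (Ts j \<omega>))) < p"
      if "u \<in> F" for u
      using lim that d(2)[of u] F(1) by (intro order_tendstoD(2)) auto
    then have "\<forall>\<^sub>F n in sequentially. \<forall>u\<in>F. (1 / real n) *\<^sub>R (\<Sum>j<n. of_bool (slab u (2 * d u) (Ts j \<omega>))) < p"
      by (intro eventually_ball_finite F(2)) auto
    with eventually_gt_at_top[of 0] show "\<forall>\<^sub>F n in sequentially. spread_sample n (\<lambda>j. Ts j \<omega>) \<epsilon>"
    proof eventually_elim
      fix n :: nat assume n: "n > 0"
        and avg: "\<forall>u\<in>F. (1 / real n) *\<^sub>R (\<Sum>j<n. of_bool (slab u (2 * d u) (Ts j \<omega>))) < p"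
      show "spread_sample n (\<lambda>j. Ts j \<omega>) \<epsilon>"
      proof
        fix v :: "complex^'d" assume "norm v = 1"
        then have "v \<in> sphere 0 1" by simp
        then obtain u where u: "u \<in> F" "norm (u - v) < d u"
          using F(3) by (auto simp: dist_norm)
        have sub: "slab u (2 * d u) t" if "norm (adj t *v v) < \<epsilon> * norm t" for t
        proof -
          have t: "norm t > 0" using that by (cases "t = 0") auto
          have "adj t *v u = adj t *v v + adj t *v (u - v)" by (simp add: matrix_vector_mult_diff_distrib)
          then have "norm (adj t *v u) \<le> norm (adj t *v v) + norm (adj t *v (u - v))"
            by (simp only: norm_triangle_ineq)
          also have "norm (adj t *v (u - v)) \<le> norm t * norm (u - v)" by (rule norm_adj_vector_le)
          also have "\<dots> \<le> norm t * d u" using u(2) by (intro mult_left_mono) auto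
          also have "norm (adj t *v v) < d u * norm t"
            using that mult_right_mono[OF eps_le[OF u(1)], of "norm t"] by simp
          finally show ?thesis by (simp add: slab_def algebra_simps)
        qed
        let ?B = "{j. j < n \<and> norm (adj (Ts j \<omega>) *v v) < \<epsilon> * norm (Ts j \<omega>)}"
        let ?S = "{j \<in> {..<n}. slab u (2 * d u) (Ts j \<omega>)}"
        have "card ?B \<le> card ?S" by (rule card_mono) (auto intro: sub)
        moreover have "(\<Sum>j<n. of_bool (slab u (2 * d u) (Ts j \<omega>))) = real (card ?S)"
          by (simp add: of_bool_def flip: sum.inter_filter)
        ultimately have "real (card ?B) \<le> (\<Sum>j<n. of_bool (slab u (2 * d u) (Ts j \<omega>)))" by simp
        also have "\<dots> < n * p" using avg u(1) n by (simp add: divide_less_eq mult.commute)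
        finally have "real (2 * CARD('d) * card ?B) < real n" by (simp add: p_def field_simps)
        then show "2 * CARD('d) * card ?B < n" by (simp only: of_nat_less_iff)
      qed (use n eps nonzero in auto)
    qed
  qed
  then show ?thesis ..
qed

definition population_cov :: "complex^'d^'d \<Rightarrow> complex^'d^'d" where
  "population_cov G = real CARD('d) *\<^sub>R expectation (\<lambda>\<omega>. cov_term G (T \<omega>))"

lemma integrable_cov_term:
  assumes "c > 0" "G \<in> trace_one_ge c"
  shows "integrable M (\<lambda>\<omega>. cov_term G (T \<omega>))"
proof -
  obtain B where "\<And>t :: complex^'r^'d. norm (cov_term G t) \<le> B"
    using cov_term_bounds(1)[OF assms(1)] assms(2) by blast
  then show ?thesis by (intro integrable_const_bound[where B = B]) auto
qed

lemma inner_population_cov: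
  assumes "c > 0" "G \<in> trace_one_ge c"
  shows "x \<bullet> (population_cov G *v x) =
    real CARD('d) * (LINT \<omega>|M. (norm (adj (T \<omega>) *v x))\<^sup>2 / (T \<omega> \<bullet> (G ** T \<omega>)))"
proof -
  have lin: "bounded_linear (\<lambda>A :: complex^'d^'d. x \<bullet> (A *v x))"
    by (intro bounded_linear_intros bounded_bilinear.bounded_linear_left[OF bounded_bilinear_matrix_vector]
        bounded_linear_compose[OF bounded_linear_inner_right])
  have "x \<bullet> (cov_term G t *v x) = (norm (adj t *v x))\<^sup>2 / (t \<bullet> (G ** t))" for t :: "complex^'r^'d"
    using inner_adj_right[of x t "adj t *v x"]
    by (simp add: cov_term_def scaleR_matrix_vector matrix_vector_mul_assoc power2_norm_eq_inner)
  then show ?thesis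
    using integral_bounded_linear[OF lin integrable_cov_term[OF assms]]
    by (simp add: population_cov_def scaleR_matrix_vector)
qed

lemma population_fixed_point_unique:
  assumes c: "c > 0"
    and G1: "G1 \<in> trace_one_ge c" "G1 ** population_cov G1 = mat 1"
    and G2: "G2 \<in> trace_one_ge c" "G2 ** population_cov G2 = mat 1"
  shows "G1 = G2"
proof (rule fixed_point_unique[where M = M and T = T and C = "real CARD('d)"])
  have inv: "matrix_inv G = population_cov G" if "G ** population_cov G = mat 1" for G
    using that by (intro matrix_inv_unique) (simp_all add: matrix_left_right_inverse_complex)
  show "x \<bullet> (matrix_inv G1 *v x) = real CARD('d) * (LINT \<omega>|M. (norm (adj (T \<omega>) *v x))\<^sup>2 / (T \<omega> \<bullet> (G1 ** T \<omega>)))"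
    "x \<bullet> (matrix_inv G2 *v x) = real CARD('d) * (LINT \<omega>|M. (norm (adj (T \<omega>) *v x))\<^sup>2 / (T \<omega> \<bullet> (G2 ** T \<omega>)))" for x
    by (simp_all add: inv[OF G1(2)] inv[OF G2(2)] inner_population_cov[OF c] G1 G2)
  show "pos_def G1" "pos_def G2" using trace_one_ge_pos_def[OF c] G1 G2 by auto
  show "Re (trace G1) = 1" "Re (trace G2) = 1" using G1 G2 by (auto simp: trace_one_ge_def)
  show "finite_measure M" by unfold_locales
  fix v w :: "complex^'d" assume vw: "v \<noteq> 0" "w \<noteq> 0"
  show "\<not> (AE \<omega> in M. adj (T \<omega>) *v v = 0 \<or> adj (T \<omega>) *v w = 0)"
  proof
    assume "AE \<omega> in M. adj (T \<omega>) *v v = 0 \<or> adj (T \<omega>) *v w = 0"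
    with nondegenerate[OF vw(1)] nondegenerate[OF vw(2)] have "AE \<omega> in M. False"
      by eventually_elim auto
    then show False by (simp add: AE_False)
  qed
qed simp_all

text \<open>A limit found for one outcome might depend on it; uniqueness of the population fixed
  point makes it constant. Convergence is stated along with \<open>lim\<close> because
  \<open>lim\<close> has a value for divergent sequences too.\<close>

theorem Gamma_limit_consistent:
  "\<exists>\<Gamma>. pos_def \<Gamma> \<and> \<Gamma> ** population_cov \<Gamma> = mat 1 \<and>
    (AE \<omega> in M. (\<forall>\<^sub>F n in sequentially. convergent (Gamma_iter n (\<lambda>j. Ts j \<omega>))) \<and>
      (\<lambda>n. lim (Gamma_iter n (\<lambda>j. Ts j \<omega>))) \<longlonglongrightarrow> \<Gamma>)"
proof -
  obtain \<epsilon> where spread: "AE \<omega> in M. \<forall>\<^sub>F n in sequentially. spread_sample n (\<lambda>j. Ts j \<omega>) \<epsilon>"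
    using eventually_spread_sample by blast
  \<comment> \<open>The value of \<open>lower\<close> in \<open>spread_sample\<close>: a single
    compact set serves for all large \<open>n\<close> and almost all outcomes.\<close>
  define c where "c = (\<epsilon>\<^sup>2 / CARD('d)) ^ (2 * CARD('d))"
  \<comment> \<open>Positivity of \<open>\<epsilon>\<close> is part of \<open>spread_sample\<close>,
    so it follows from a single outcome and index at which that locale holds.\<close>
  have c: "c > 0"
  proof -
    have "\<exists>\<omega>. \<forall>\<^sub>F n in sequentially. spread_sample n (\<lambda>j. Ts j \<omega>) \<epsilon>"
      by (rule AE_imp_ex[OF spread])
    then obtain \<omega> n where "spread_sample n (\<lambda>j. Ts j \<omega>) \<epsilon>" by (auto simp: eventually_sequentially)
    then show ?thesis by (simp add: c_def spread_sample_def)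
  qed
  let ?avg = "\<lambda>\<omega> n G. (1 / real n) *\<^sub>R (\<Sum>j<n. cov_term G (Ts j \<omega>))"
  let ?law = "\<lambda>\<omega>. \<forall>(s :: nat \<Rightarrow> nat) y L. filterlim s at_top sequentially \<longrightarrow> (\<forall>k. y k \<in> trace_one_ge c) \<longrightarrow>
    L \<in> trace_one_ge c \<longrightarrow> y \<longlonglongrightarrow> L \<longrightarrow> (\<lambda>k. ?avg \<omega> (s k) (y k)) \<longlonglongrightarrow> expectation (\<lambda>\<omega>. cov_term L (T \<omega>))"
  obtain B where B: "\<And>G t. G \<in> trace_one_ge c \<Longrightarrow> norm (cov_term G (t :: complex^'r^'d)) \<le> B"
    using cov_term_bounds(1)[OF c] by blast
  obtain C where C: "\<And>G H t. G \<in> trace_one_ge c \<Longrightarrow> H \<in> trace_one_ge c \<Longrightarrow>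
      norm (cov_term G (t :: complex^'r^'d) - cov_term H t) \<le> C * norm (G - H)"
    using cov_term_bounds(2)[OF c] by blast
  \<comment> \<open>The null set is fixed before \<open>s\<close>, \<open>y\<close> and
    \<open>L\<close> are chosen, since the sequences used below depend on the outcome.\<close>
  have law: "AE \<omega> in M. ?law \<omega>"
    by (rule slln_lipschitz[OF measurable_cov_term B C])
  have limit: "\<exists>L. L \<in> trace_one_ge c \<and> L ** population_cov L = mat 1 \<and>
      (\<forall>\<^sub>F n in sequentially. convergent (Gamma_iter n (\<lambda>j. Ts j \<omega>))) \<and>
      (\<lambda>n. lim (Gamma_iter n (\<lambda>j. Ts j \<omega>))) \<longlonglongrightarrow> L"
    if spread: "\<forall>\<^sub>F n in sequentially. spread_sample n (\<lambda>j. Ts j \<omega>) \<epsilon>" and law: "?law \<omega>" for \<omega>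
  proof -
    define X where "X = (\<lambda>j. Ts j \<omega>)"
    define G where "G n = lim (Gamma_iter n X)" for n
    obtain n0 where n0: "\<And>n. n \<ge> n0 \<Longrightarrow> spread_sample n X \<epsilon>"
      using spread by (auto simp: eventually_sequentially X_def)
    have G: "G n \<in> trace_one_ge c" "convergent (Gamma_iter n X)" "G n ** weighted_cov n X (G n) = mat 1"
      if "n \<ge> n0" for n
    proof -
      interpret spread_sample n X \<epsilon> by (rule n0[OF that])
      obtain L where L: "L \<in> trace_one_ge c" "Gamma_iter n X \<longlonglongrightarrow> L" "L ** weighted_cov n X L = mat 1"
        using Gamma_iter_tendsto_fixed_point unfolding lower_def c_def by blast
      have "G n = L" unfolding G_def by (rule limI[OF L(2)])
      then show "G n \<in> trace_one_ge c" "G n ** weighted_cov n X (G n) = mat 1" using L by simp_all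
      show "convergent (Gamma_iter n X)" using L(2) by (rule convergentI)
    qed
    \<comment> \<open>From \<open>n0\<close> on, \<open>G n\<close> is a genuine limit and lies in
      the compact set.\<close>
    define y where "y k = G (k + n0)" for k
    have y: "y k \<in> trace_one_ge c" for k by (simp add: y_def G(1))
    have fixed: "L \<in> trace_one_ge c \<and> L ** population_cov L = mat 1"
      if r: "strict_mono r" and L: "(y \<circ> r) \<longlonglongrightarrow> L" for r L
    proof -
      have Lc: "L \<in> trace_one_ge c"
        by (rule closed_sequentially[OF compact_imp_closed[OF compact_trace_one_ge[OF c]] _ L]) (simp add: y)
      have "filterlim (\<lambda>k. r k + n0) at_top sequentially"
        using filterlim_compose[OF filterlim_add_const_nat_at_top filterlim_subseq[OF r]] .
      then have "(\<lambda>k. ?avg \<omega> (r k + n0) ((y \<circ> r) k)) \<longlonglongrightarrow> expectation (\<lambda>\<omega>. cov_term L (T \<omega>))"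
        using law[rule_format, of "\<lambda>k. r k + n0" "y \<circ> r" L] y Lc L by simp
      then have "(\<lambda>k. real CARD('d) *\<^sub>R ?avg \<omega> (r k + n0) ((y \<circ> r) k)) \<longlonglongrightarrow> population_cov L"
        unfolding population_cov_def by (intro tendsto_intros)
      then have "(\<lambda>k. (y \<circ> r) k ** weighted_cov (r k + n0) X ((y \<circ> r) k)) \<longlonglongrightarrow> L ** population_cov L"
        unfolding weighted_cov_eq X_def by (intro tendsto_matrix_mult L)
      moreover have "(y \<circ> r) k ** weighted_cov (r k + n0) X ((y \<circ> r) k) = mat 1" for k
        by (simp add: y_def G(3))
      ultimately have "L ** population_cov L = mat 1"
        by (simp add: LIMSEQ_const_iff)
      with Lc show ?thesis by simp
    qed
    obtain L r where "L \<in> trace_one_ge c" and L: "strict_mono r" "(y \<circ> r) \<longlonglongrightarrow> L"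
      by (rule seq_compactE[OF compact_imp_seq_compact[OF compact_trace_one_ge[OF c]], of y]) (simp add: y)
    note L = fixed[OF L]
    have "y \<longlonglongrightarrow> L"
    proof (rule compact_unique_limit_point[OF compact_trace_one_ge[OF c] y])
      fix r l assume "strict_mono r" "(y \<circ> r) \<longlonglongrightarrow> l"
      note l = fixed[OF this]
      show "l = L" by (rule population_fixed_point_unique[OF c]) (use l L in simp_all)
    qed
    then have "G \<longlonglongrightarrow> L" unfolding y_def by (rule LIMSEQ_offset)
    moreover have "\<forall>\<^sub>F n in sequentially. convergent (Gamma_iter n X)"
      by (rule eventually_mono[OF eventually_ge_at_top[of n0]]) (rule G(2))
    ultimately show ?thesis using L unfolding G_def X_def by blast
  qed
  have "AE \<omega> in M. (\<forall>\<^sub>F n in sequentially. spread_sample n (\<lambda>j. Ts j \<omega>) \<epsilon>) \<and> ?law \<omega>"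
    using spread law by (rule eventually_conj)
  moreover from this have "\<exists>\<omega>. (\<forall>\<^sub>F n in sequentially. spread_sample n (\<lambda>j. Ts j \<omega>) \<epsilon>) \<and> ?law \<omega>"
    by (rule AE_imp_ex)
  \<comment> \<open>One good outcome supplies \<open>\<Gamma>\<close>; the limit \<open>L\<close> of
    any other good outcome is identified with it by uniqueness.\<close>
  then obtain \<Gamma> where \<Gamma>: "\<Gamma> \<in> trace_one_ge c" "\<Gamma> ** population_cov \<Gamma> = mat 1"
    using limit by blast
  ultimately have "AE \<omega> in M. (\<forall>\<^sub>F n in sequentially. convergent (Gamma_iter n (\<lambda>j. Ts j \<omega>))) \<and>
      (\<lambda>n. lim (Gamma_iter n (\<lambda>j. Ts j \<omega>))) \<longlonglongrightarrow> \<Gamma>"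
  proof (elim eventually_mono)
    fix \<omega> assume "(\<forall>\<^sub>F n in sequentially. spread_sample n (\<lambda>j. Ts j \<omega>) \<epsilon>) \<and> ?law \<omega>"
    then obtain L where L: "L \<in> trace_one_ge c" "L ** population_cov L = mat 1"
      "\<forall>\<^sub>F n in sequentially. convergent (Gamma_iter n (\<lambda>j. Ts j \<omega>))"
      "(\<lambda>n. lim (Gamma_iter n (\<lambda>j. Ts j \<omega>))) \<longlonglongrightarrow> L"
      using limit by blast
    have "L = \<Gamma>" by (rule population_fixed_point_unique[OF c L(1,2) \<Gamma>])
    with L show "(\<forall>\<^sub>F n in sequentially. convergent (Gamma_iter n (\<lambda>j. Ts j \<omega>))) \<and>
      (\<lambda>n. lim (Gamma_iter n (\<lambda>j. Ts j \<omega>))) \<longlonglongrightarrow> \<Gamma>" by simp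
  qed
  with \<Gamma> trace_one_ge_pos_def[OF c] show ?thesis by blast
qed

end

text \<open>The density makes null sets of the reference measure null for the law of
  \<open>T\<close>, which yields the nondegeneracy assumption of
  \<open>nondegenerate_sample\<close>. The equation for the inverse is
  \<open>\<Gamma> ** population_cov \<Gamma> = mat 1\<close> solved for
  \<open>matrix_inv \<Gamma>\<close>.\<close>

theorem theorem5p1:
  fixes M :: "'a measure"
    and is_real :: bool
    and T :: "'a \<Rightarrow> complex^'r^'d"
    and Ts :: "nat \<Rightarrow> 'a \<Rightarrow> complex^'r^'d"
    and f :: "complex^'r^'d \<Rightarrow> ennreal"
  assumes "prob_space M"
    and "distributed M (Kmat_lebesgue is_real) T f"
    and "prob_space.indep_vars M (\<lambda>_. Kmat_lebesgue is_real) Ts UNIV"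
    and "\<And>j. distr M (Kmat_lebesgue is_real) (Ts j) = distr M (Kmat_lebesgue is_real) T"
  shows "\<exists>\<Gamma>::complex^'d^'d. pos_def \<Gamma> \<and>
     (AE \<omega> in M.
        (\<forall>\<^sub>F n in sequentially. convergent (Gamma_iter n (\<lambda>j. Ts j \<omega>))) \<and>
        (\<lambda>n. lim (Gamma_iter n (\<lambda>j. Ts j \<omega>))) \<longlonglongrightarrow> \<Gamma>) \<and>
     matrix_inv \<Gamma> = mscale (of_nat CARD('d))
        (LINT \<omega>|M. mscale (1 / trace (adj (T \<omega>) ** matrix_inv (matrix_inv \<Gamma>) ** T \<omega>))
                          (T \<omega> ** adj (T \<omega>)))"
proof -
  interpret prob_space M by fact
  have T: "T \<in> measurable M (Kmat_lebesgue is_real)"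
    and distr: "distr M (Kmat_lebesgue is_real) T = density (Kmat_lebesgue is_real) f"
    and f: "f \<in> borel_measurable (Kmat_lebesgue is_real)"
    using assms(2) by (auto simp: distributed_def)
  interpret nondegenerate_sample M "Kmat_lebesgue is_real" T Ts
  proof
    show "sets (Kmat_lebesgue is_real) = sets (borel :: (complex^'r^'d) measure)"
      by (rule sets_Kmat_lebesgue)
    fix v :: "complex^'d" assume "v \<noteq> 0"
    from AE_Kmat_lebesgue_nonorthogonal[OF this, of is_real]
    have "AE t in density (Kmat_lebesgue is_real) f. adj t *v v \<noteq> 0"
      unfolding AE_density[OF f] by (rule eventually_mono) simp
    then show "AE \<omega> in M. adj (T \<omega>) *v v \<noteq> 0"
      unfolding distr[symmetric] by (rule AE_distrD[OF T])
  qed (use T assms in auto)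
  obtain \<Gamma> where \<Gamma>: "pos_def \<Gamma>" "\<Gamma> ** population_cov \<Gamma> = mat 1"
    and lim: "AE \<omega> in M. (\<forall>\<^sub>F n in sequentially. convergent (Gamma_iter n (\<lambda>j. Ts j \<omega>))) \<and>
      (\<lambda>n. lim (Gamma_iter n (\<lambda>j. Ts j \<omega>))) \<longlonglongrightarrow> \<Gamma>"
    using Gamma_limit_consistent by blast
  have "matrix_inv \<Gamma> = population_cov \<Gamma>"
    using \<Gamma>(2) by (intro matrix_inv_unique) (simp_all add: matrix_left_right_inverse_complex)
  moreover have "matrix_inv (matrix_inv \<Gamma>) = \<Gamma>"
    by (intro matrix_inv_unique pos_def_inv_left pos_def_inv_right \<Gamma>(1))
  moreover have "mscale (1 / trace (adj t ** \<Gamma> ** t)) (t ** adj t) = cov_term \<Gamma> t" for t :: "complex^'r^'d"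
    by (simp add: cov_term_def trace_adj_mult_real[OF pos_def_adj[OF \<Gamma>(1)]] flip: mscale_of_real)
  moreover have "mscale (of_nat CARD('d)) A = real CARD('d) *\<^sub>R A" for A :: "complex^'d^'d"
    by (simp flip: mscale_of_real)
  ultimately have "matrix_inv \<Gamma> = mscale (of_nat CARD('d))
      (LINT \<omega>|M. mscale (1 / trace (adj (T \<omega>) ** matrix_inv (matrix_inv \<Gamma>) ** T \<omega>)) (T \<omega> ** adj (T \<omega>)))"
    by (simp add: population_cov_def)
  with \<Gamma>(1) lim show ?thesis by blast
qed

end
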